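(* Let $H$ be a Hilbert space, let $T\in B(H)$, and let $E_{21}=\begin{bmatrix}0&0\\1&0\end{bmatrix}\in M_2(\mathbb{C})$. The following statements are equivalent: (1) $w(T)\leq 1/2$; (2) there exists a unital completely positive map $\varphi:M_2(\mathbb{C})\to B(H)$ with $T=\varphi(E_{21})$.
   Context: $B(H)$ denotes the bounded linear operators on $H$. The numerical range of $T\in B(H)$ is $\mathbb{W}_1(T)=\{f(T): f \text{ is a state of } B(H)\}$ (this contains $\{\langle T\xi,\xi\rangle:\ \xi\in H,\ \|\xi\|=1\}$ as a dense subset), and the numerical radius is $w(T)=\sup\{|\lambda|:\lambda\in\mathbb{W}_1(T)\}$. *)

theory Defs
  imports "HOL-Analysis.Analysis"
begin

text \<open>Complex Hilbert spaces, with inner product linear in the first argument. The real scalar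
  multiplication, norm and completeness come from \<^class>\<open>banach\<close>; the last two axioms say that the
  real structure is the restriction of the complex one and that the norm is induced by the
  inner product. The zero space is allowed.\<close>

class complex_hilbert = banach +
  fixes scaleC :: "complex \<Rightarrow> 'a \<Rightarrow> 'a" (infixr "*\<^sub>C" 75)
    and cinner :: "'a \<Rightarrow> 'a \<Rightarrow> complex"
  assumes scaleC_add_right: "c *\<^sub>C (x + y) = c *\<^sub>C x + c *\<^sub>C y"
    and scaleC_add_left: "(c + d) *\<^sub>C x = c *\<^sub>C x + d *\<^sub>C x"
    and scaleC_scaleC: "c *\<^sub>C (d *\<^sub>C x) = (c * d) *\<^sub>C x"
    and scaleC_one: "1 *\<^sub>C x = x"
    and cinner_add_left: "cinner (x + y) z = cinner x z + cinner y z"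
    and cinner_scaleC_left: "cinner (c *\<^sub>C x) y = c * cinner x y"
    and cinner_commute: "cinner x y = cnj (cinner y x)"
    and scaleR_scaleC: "r *\<^sub>R x = complex_of_real r *\<^sub>C x"
    and cinner_self: "cinner x x = complex_of_real ((norm x)\<^sup>2)"

instantiation complex :: complex_hilbert
begin

definition scaleC_complex_def: "c *\<^sub>C x = c * (x::complex)"
definition cinner_complex_def: "cinner x y = x * cnj (y::complex)"

instance
proof
  fix x y z c d :: complex and r :: real
  show "c *\<^sub>C (x + y) = c *\<^sub>C x + c *\<^sub>C y"
    by (simp add: scaleC_complex_def distrib_left)
  show "(c + d) *\<^sub>C x = c *\<^sub>C x + d *\<^sub>C x"
    by (simp add: scaleC_complex_def distrib_right)
  show "c *\<^sub>C (d *\<^sub>C x) = (c * d) *\<^sub>C x"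
    by (simp add: scaleC_complex_def)
  show "1 *\<^sub>C x = x"
    by (simp add: scaleC_complex_def)
  show "cinner (x + y) z = cinner x z + cinner y z"
    by (simp add: cinner_complex_def distrib_right)
  show "cinner (c *\<^sub>C x) y = c * cinner x y"
    by (simp add: cinner_complex_def scaleC_complex_def)
  show "cinner x y = cnj (cinner y x)"
    by (simp add: cinner_complex_def)
  show "r *\<^sub>R x = complex_of_real r *\<^sub>C x"
    by (simp add: scaleC_complex_def scaleR_conv_of_real)
  show "cinner x x = complex_of_real ((norm x)\<^sup>2)"
    unfolding cinner_complex_def by (rule complex_norm_square[symmetric])
qed

end

text \<open>Finite direct sums; in particular \<^typ>\<open>complex^2\<close> is the Hilbert space \<open>\<complex>\<^sup>2\<close>, and on
  matrices \<open>c *\<^sub>C A\<close> is entrywise scalar multiplication.\<close>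

instantiation vec :: (complex_hilbert, finite) complex_hilbert
begin

definition scaleC_vec_def: "c *\<^sub>C x = (\<chi> i. c *\<^sub>C (x $ i))"
definition cinner_vec_def: "cinner x y = (\<Sum>i\<in>UNIV. cinner (x $ i) (y $ i))"

instance
proof
  fix x y z :: "'a ^ 'b" and c d :: complex and r :: real
  show "c *\<^sub>C (x + y) = c *\<^sub>C x + c *\<^sub>C y"
    by (simp add: scaleC_vec_def vec_eq_iff scaleC_add_right)
  show "(c + d) *\<^sub>C x = c *\<^sub>C x + d *\<^sub>C x"
    by (simp add: scaleC_vec_def vec_eq_iff scaleC_add_left)
  show "c *\<^sub>C (d *\<^sub>C x) = (c * d) *\<^sub>C x"
    by (simp add: scaleC_vec_def vec_eq_iff scaleC_scaleC)
  show "1 *\<^sub>C x = x"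
    by (simp add: scaleC_vec_def vec_eq_iff scaleC_one)
  show "cinner (x + y) z = cinner x z + cinner y z"
    by (simp add: cinner_vec_def cinner_add_left sum.distrib)
  show "cinner (c *\<^sub>C x) y = c * cinner x y"
    by (simp add: cinner_vec_def scaleC_vec_def cinner_scaleC_left sum_distrib_left)
  show "cinner x y = cnj (cinner y x)"
    unfolding cinner_vec_def cnj_sum by (rule sum.cong[OF refl cinner_commute])
  show "r *\<^sub>R x = complex_of_real r *\<^sub>C x"
    by (simp add: scaleC_vec_def vec_eq_iff scaleR_scaleC)
  show "cinner x x = complex_of_real ((norm x)\<^sup>2)"
    by (simp add: cinner_vec_def norm_vec_def L2_set_def cinner_self sum_nonneg)
qed

end

text \<open>The algebra \<open>B(H)\<close>, as a set of functions on \<open>H\<close>.\<close>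

definition bounded_operators :: "('a::complex_hilbert \<Rightarrow> 'a) set" where
  "bounded_operators = {T. bounded_linear T \<and> (\<forall>c x. T (c *\<^sub>C x) = c *\<^sub>C T x)}"

definition positive_operator :: "('a::complex_hilbert \<Rightarrow> 'a) \<Rightarrow> bool" where
  "positive_operator T \<longleftrightarrow> T \<in> bounded_operators \<and> (\<forall>\<xi>. cinner (T \<xi>) \<xi> \<in> \<real>\<^sub>\<ge>\<^sub>0)"

text \<open>States of \<open>B(H)\<close>. Only the values of \<open>f\<close> on \<^const>\<open>bounded_operators\<close> matter.\<close>

definition state :: "(('a::complex_hilbert \<Rightarrow> 'a) \<Rightarrow> complex) \<Rightarrow> bool" where
  "state f \<longleftrightarrow>
     (\<forall>S\<in>bounded_operators. \<forall>T\<in>bounded_operators. f (\<lambda>x. S x + T x) = f S + f T) \<and>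
     (\<forall>c. \<forall>T\<in>bounded_operators. f (\<lambda>x. c *\<^sub>C T x) = c * f T) \<and>
     (\<forall>T. positive_operator T \<longrightarrow> f T \<in> \<real>\<^sub>\<ge>\<^sub>0) \<and>
     f (\<lambda>x. x) = 1"

definition numerical_range :: "('a::complex_hilbert \<Rightarrow> 'a) \<Rightarrow> complex set" where
  "numerical_range T = {f T | f. state f}"

text \<open>The inserted \<open>0\<close> only matters for \<open>H = 0\<close>, where there are no states; it makes the supremum
  of the empty set of moduli equal to \<open>0\<close>.\<close>

definition numerical_radius :: "('a::complex_hilbert \<Rightarrow> 'a) \<Rightarrow> real" where
  "numerical_radius T = (SUP z\<in>insert 0 (numerical_range T). cmod z)"

text \<open>Positivity of the \<open>n \<times> n\<close> operator matrix \<open>(M i j)\<close>, \<open>i, j < n\<close>, as an element of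
  \<open>M\<^sub>n(B(H)) = B(H\<^sup>n)\<close>: the inner product of \<open>M \<xi>\<close> with \<open>\<xi>\<close> in \<open>H\<^sup>n\<close>, where
  \<open>(M \<xi>)\<^sub>i = (\<Sum>j<n. M i j (\<xi> j))\<close>, is a nonnegative real for all \<open>\<xi>\<close>.\<close>

definition positive_operator_matrix ::
    "nat \<Rightarrow> (nat \<Rightarrow> nat \<Rightarrow> 'a::complex_hilbert \<Rightarrow> 'a) \<Rightarrow> bool" where
  "positive_operator_matrix n M \<longleftrightarrow>
     (\<forall>i<n. \<forall>j<n. M i j \<in> bounded_operators) \<and>
     (\<forall>\<xi>. (\<Sum>i<n. cinner (\<Sum>j<n. M i j (\<xi> j)) (\<xi> i)) \<in> \<real>\<^sub>\<ge>\<^sub>0)"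

text \<open>Completely positive linear maps \<open>M\<^sub>k(\<complex>) \<rightarrow> B(H)\<close>; a matrix \<open>A\<close> is identified with the operator
  \<open>(*v) A\<close> on \<open>\<complex>\<^sup>k\<close>, so that \<open>M\<^sub>n(M\<^sub>k(\<complex>)) = B((\<complex>\<^sup>k)\<^sup>n)\<close>.\<close>

definition completely_positive ::
    "(complex ^ 'k ^ 'k \<Rightarrow> 'a::complex_hilbert \<Rightarrow> 'a) \<Rightarrow> bool" where
  "completely_positive \<phi> \<longleftrightarrow>
     (\<forall>A. \<phi> A \<in> bounded_operators) \<and>
     (\<forall>A B. \<phi> (A + B) = (\<lambda>x. \<phi> A x + \<phi> B x)) \<and>
     (\<forall>c A. \<phi> (c *\<^sub>C A) = (\<lambda>x. c *\<^sub>C \<phi> A x)) \<and>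
     (\<forall>n A. positive_operator_matrix n (\<lambda>i j. (*v) (A i j)) \<longrightarrow>
            positive_operator_matrix n (\<lambda>i j. \<phi> (A i j)))"

definition unital :: "(complex ^ 'k ^ 'k \<Rightarrow> 'a::complex_hilbert \<Rightarrow> 'a) \<Rightarrow> bool" where
  "unital \<phi> \<longleftrightarrow> \<phi> (mat 1) = (\<lambda>x. x)"

definition E21 :: "complex ^ 2 ^ 2" where
  "E21 = vector [vector [0, 0], vector [1, 0]]"

end

theory Submission
  imports Defs
begin

text \<open>A unital completely positive map with \<open>\<phi> E\<^sub>2\<^sub>1 = T\<close> is the same as an operator \<open>A\<close> for which
  the Choi matrix \<open>[[1 - A, T\<^sup>*], [T, A]]\<close> is positive. Given such a \<open>\<phi>\<close>, the matrices
  \<open>[[1, cnj u], [u, 1]]\<close> with \<open>\<bar>u\<bar> = 1\<close> are positive, so every state \<open>f\<close> has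
  \<open>1 + 2 Re (u f(T)) \<ge> 0\<close>, that is \<open>\<bar>f(T)\<bar> \<le> 1/2\<close>. Conversely, \<open>w(T) \<le> 1/2\<close> makes the tridiagonal
  Toeplitz form \<open>\<Sum> \<parallel>\<xi>\<^sub>i\<parallel>\<^sup>2 + 2 Re \<Sum> \<langle>T \<xi>\<^sub>i, \<xi>\<^sub>i\<^sub>+\<^sub>1\<rangle>\<close> nonnegative, and its infimum over all finite
  sequences with \<open>\<xi>\<^sub>0 = x\<close> is a quadratic form \<open>\<langle>A x, x\<rangle>\<close> with the required property.\<close>

subsection \<open>Complex Hilbert spaces and bounded operators\<close>

lemma cinner_add_right: "cinner x (y + z) = cinner x y + cinner (x::'a::complex_hilbert) z"
  by (metis cinner_commute cinner_add_left complex_cnj_add)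

lemma cinner_scaleC_right: "cinner x (c *\<^sub>C y) = cnj c * cinner (x::'a::complex_hilbert) y"
  by (metis cinner_commute cinner_scaleC_left complex_cnj_mult)

lemma scaleC_zero_left: "0 *\<^sub>C (x::'a::complex_hilbert) = 0"
  using scaleC_add_left[of 0 0 x] by simp

lemma scaleC_zero_right: "c *\<^sub>C (0::'a::complex_hilbert) = 0"
  using scaleC_add_right[of c 0 "0::'a"] by simp

lemma scaleC_minus_right: "c *\<^sub>C (- x) = - (c *\<^sub>C (x::'a::complex_hilbert))"
  using scaleC_add_right[of c x "- x"] by (simp add: scaleC_zero_right eq_neg_iff_add_eq_0 add.commute)

lemma scaleC_minus_left: "(- c) *\<^sub>C x = - (c *\<^sub>C (x::'a::complex_hilbert))"
  using scaleC_add_left[of c "- c" x] by (simp add: scaleC_zero_left eq_neg_iff_add_eq_0 add.commute)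

lemma scaleC_diff_right: "c *\<^sub>C (x - y) = c *\<^sub>C x - c *\<^sub>C (y::'a::complex_hilbert)"
  using scaleC_add_right[of c x "- y"] by (simp add: scaleC_minus_right)

lemma scaleC_sum_right: "c *\<^sub>C (\<Sum>i\<in>I. f i) = (\<Sum>i\<in>I. c *\<^sub>C (f i::'a::complex_hilbert))"
  by (induction I rule: infinite_finite_induct) (simp_all add: scaleC_add_right scaleC_zero_right)

lemma cinner_zero_left: "cinner 0 (x::'a::complex_hilbert) = 0"
  using cinner_add_left[of 0 0 x] by simp

lemma cinner_zero_right: "cinner (x::'a::complex_hilbert) 0 = 0"
  using cinner_add_right[of x 0 0] by simp

lemma cinner_minus_left: "cinner (- x) y = - cinner (x::'a::complex_hilbert) y"
  using cinner_add_left[of x "- x" y] by (simp add: cinner_zero_left eq_neg_iff_add_eq_0 add.commute)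

lemma cinner_minus_right: "cinner x (- y) = - cinner (x::'a::complex_hilbert) y"
  using cinner_add_right[of x y "- y"] by (simp add: cinner_zero_right eq_neg_iff_add_eq_0 add.commute)

lemma cinner_diff_left: "cinner (x - y) z = cinner x z - cinner (y::'a::complex_hilbert) z"
  using cinner_add_left[of x "- y" z] by (simp add: cinner_minus_left)

lemma cinner_diff_right: "cinner x (y - z) = cinner x y - cinner (x::'a::complex_hilbert) z"
  using cinner_add_right[of x y "- z"] by (simp add: cinner_minus_right)

lemma cinner_sum_left: "cinner (\<Sum>i\<in>I. f i) y = (\<Sum>i\<in>I. cinner (f i::'a::complex_hilbert) y)"
  by (induction I rule: infinite_finite_induct) (simp_all add: cinner_add_left cinner_zero_left)

lemma cinner_sum_right: "cinner x (\<Sum>i\<in>I. f i) = (\<Sum>i\<in>I. cinner (x::'a::complex_hilbert) (f i))"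
  by (induction I rule: infinite_finite_induct) (simp_all add: cinner_add_right cinner_zero_right)

lemma cinner_scaleR_left: "cinner (r *\<^sub>R x) y = of_real r * cinner (x::'a::complex_hilbert) y"
  by (simp add: scaleR_scaleC cinner_scaleC_left)

lemma cinner_scaleR_right: "cinner x (r *\<^sub>R y) = of_real r * cinner (x::'a::complex_hilbert) y"
  by (simp add: scaleR_scaleC cinner_scaleC_right)

lemmas cinner_simps = cinner_add_left cinner_add_right cinner_diff_left cinner_diff_right
  cinner_minus_left cinner_minus_right cinner_scaleC_left cinner_scaleC_right
  cinner_scaleR_left cinner_scaleR_right cinner_zero_left cinner_zero_right

lemma Re_cinner_commute: "Re (cinner x y) = Re (cinner (y::'a::complex_hilbert) x)"
  by (subst cinner_commute) simp

lemma norm_scaleC: "norm (c *\<^sub>C (x::'a::complex_hilbert)) = cmod c * norm x"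
proof -
  have "complex_of_real ((norm (c *\<^sub>C x))\<^sup>2) = c * cnj c * complex_of_real ((norm x)\<^sup>2)"
    by (simp only: cinner_self[symmetric] cinner_scaleC_left cinner_scaleC_right ac_simps)
  also have "\<dots> = complex_of_real ((cmod c * norm x)\<^sup>2)"
    by (simp add: complex_norm_square[symmetric] power_mult_distrib)
  finally have "(norm (c *\<^sub>C x))\<^sup>2 = (cmod c * norm x)\<^sup>2"
    using of_real_eq_iff by blast
  then show ?thesis
    by (simp add: power2_eq_iff_nonneg)
qed

lemma norm_add_power2: "(norm (x + y))\<^sup>2 = (norm x)\<^sup>2 + 2 * Re (cinner (x::'a::complex_hilbert) y) + (norm y)\<^sup>2"
proof -
  have "(norm z)\<^sup>2 = Re (cinner z z)" for z :: 'a
    by (simp add: cinner_self)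
  then show ?thesis
    using Re_cinner_commute[of x y] by (simp add: cinner_simps)
qed

lemma norm_diff_power2: "(norm (x - y))\<^sup>2 = (norm x)\<^sup>2 - 2 * Re (cinner (x::'a::complex_hilbert) y) + (norm y)\<^sup>2"
  using norm_add_power2[of x "- y"] by (simp add: cinner_simps)

text \<open>Cauchy-Schwarz for real parts: expanding the squared norm of
  \<open>norm y *\<^sub>R x - norm x *\<^sub>R y\<close> gives the difference of the two sides times
  \<open>2 * (norm x * norm y)\<close>.\<close>

lemma Re_cinner_le: "Re (cinner (x::'a::complex_hilbert) y) \<le> norm x * norm y"
proof (cases "x = 0 \<or> y = 0")
  case True
  then show ?thesis by (auto simp: cinner_simps)
next
  case False
  have "0 \<le> (norm (norm y *\<^sub>R x - norm x *\<^sub>R y))\<^sup>2" by simp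
  also have "\<dots> = 2 * (norm x * norm y) * (norm x * norm y - Re (cinner x y))"
    by (simp only: norm_diff_power2) (simp add: cinner_simps power2_eq_square algebra_simps)
  finally have "0 \<le> 2 * (norm x * norm y) * (norm x * norm y - Re (cinner x y))" .
  moreover have "0 < 2 * (norm x * norm y)" using False by simp
  ultimately have "0 \<le> norm x * norm y - Re (cinner x y)"
    using zero_le_mult_iff by (metis less_le_not_le)
  then show ?thesis by simp
qed

lemma cmod_cinner_le: "cmod (cinner (x::'a::complex_hilbert) y) \<le> norm x * norm y"
proof (cases "cinner x y = 0")
  case False
  \<comment> \<open>A unimodular factor that turns the inner product into its modulus, so that the
    bound on real parts applies.\<close>
  define u where "u = cnj (sgn (cinner x y))"
  have u: "cmod u = 1" using False by (simp add: u_def norm_sgn)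
  have "u * cinner x y = of_real (cmod (cinner x y))"
    using False
    by (simp add: u_def sgn_eq complex_norm_square[symmetric] power2_eq_square mult.commute)
  then have "cmod (cinner x y) = Re (cinner (u *\<^sub>C x) y)"
    by (simp add: cinner_simps)
  also have "\<dots> \<le> norm (u *\<^sub>C x) * norm y" by (rule Re_cinner_le)
  finally show ?thesis by (simp add: norm_scaleC u)
qed simp

section \<open>Closure properties of the bounded operators\<close>

lemma bounded_operators_I:
  assumes "\<And>x y. T (x + y) = T x + T y" and "\<And>c x. T (c *\<^sub>C x) = c *\<^sub>C T x"
    and "\<And>x. norm (T x) \<le> norm x * K"
  shows "(T::'a::complex_hilbert \<Rightarrow> 'a) \<in> bounded_operators"
  unfolding bounded_operators_def
  using assms by (auto intro!: bounded_linear_intro[where K = K] simp: scaleR_scaleC)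

lemma bounded_operators_add:
  "S \<in> bounded_operators \<Longrightarrow> T \<in> bounded_operators \<Longrightarrow> (\<lambda>x. S x + T x) \<in> bounded_operators"
  by (auto simp: bounded_operators_def scaleC_add_right intro: bounded_linear_add)

lemma bounded_operators_diff:
  "S \<in> bounded_operators \<Longrightarrow> T \<in> bounded_operators \<Longrightarrow> (\<lambda>x. S x - T x) \<in> bounded_operators"
  by (auto simp: bounded_operators_def scaleC_diff_right intro: bounded_linear_sub)

lemma bounded_linear_scaleC: "bounded_linear (\<lambda>x::'a::complex_hilbert. c *\<^sub>C x)"
  by (rule bounded_linear_intro[where K = "cmod c"])
    (simp_all add: scaleC_add_right scaleR_scaleC scaleC_scaleC norm_scaleC mult.commute)

lemma bounded_operators_scaleC:
  assumes "T \<in> bounded_operators" shows "(\<lambda>x. c *\<^sub>C T x) \<in> bounded_operators"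
  using assms bounded_linear_compose[OF bounded_linear_scaleC, of T c]
  by (auto simp: bounded_operators_def scaleC_scaleC mult.commute)

lemma bounded_operators_id: "(\<lambda>x. x) \<in> bounded_operators"
  by (auto simp: bounded_operators_def)

lemma bounded_operators_sum:
  assumes "\<And>i. i \<in> I \<Longrightarrow> T i \<in> bounded_operators"
  shows "(\<lambda>x. \<Sum>i\<in>I. T i x) \<in> bounded_operators"
  using assms
  by (auto simp: bounded_operators_def scaleC_sum_right intro: bounded_linear_sum)

section \<open>Riesz representation, operators from bilinear forms, adjoints\<close>

text \<open>The representing vector is the minimiser of the energy
  \<open>(norm x)\<^sup>2 - 2 * f x\<close>. A minimising sequence is Cauchy, and completeness
  provides its limit.\<close>

lemma riesz_representation_real:
  fixes f :: "'a::complex_hilbert \<Rightarrow> real"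
  assumes f: "bounded_linear f"
  shows "\<exists>z. \<forall>y. f y = Re (cinner z y)"
proof -
  interpret f: bounded_linear f by fact
  define J where "J x = (norm x)\<^sup>2 - 2 * f x" for x
  define m where "m = (INF x. J x)"
  obtain K where K: "\<And>x. norm (f x) \<le> norm x * K" using f.bounded by blast
  have lower: "- K\<^sup>2 \<le> J x" for x
  proof -
    have "0 \<le> (norm x - K)\<^sup>2" by simp
    then show ?thesis
      using K[of x] by (simp add: J_def power2_eq_square algebra_simps)
  qed
  then have bdd: "bdd_below (range J)" by (intro bdd_belowI2)
  have m_le: "m \<le> J x" for x
    unfolding m_def by (rule cINF_lower[OF bdd]) simp
  have "\<exists>x. J x < m + e" if "e > 0" for e
    using cINF_less_iff[OF _ bdd, of "m + e"] that by (auto simp: m_def)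
  then have "\<forall>n. \<exists>x. J x < m + inverse (real (Suc n))" by simp
  then obtain X where X: "\<And>n. J (X n) < m + inverse (real (Suc n))" by metis
  \<comment> \<open>\<open>m\<close> bounds \<open>J\<close> from below at the midpoint of
    \<open>x\<close> and \<open>y\<close>, so the parallelogram law forces near-minimisers close
    together.\<close>
  have para: "(norm (x - y))\<^sup>2 \<le> 2 * (J x - m) + 2 * (J y - m)" for x y
  proof -
    have "J ((1/2) *\<^sub>R (x + y)) = (norm (x + y))\<^sup>2 / 4 - (f x + f y)"
      by (simp only: J_def f.scaleR f.add norm_scaleR power_mult_distrib) (simp add: power_divide field_simps)
    then have "(norm (x - y))\<^sup>2 = 2 * J x + 2 * J y - 4 * J ((1/2) *\<^sub>R (x + y))"
      using norm_diff_power2[of x y] norm_add_power2[of x y] by (simp only: J_def) argo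
    then show ?thesis using m_le[of "(1/2) *\<^sub>R (x + y)"] by argo
  qed
  have "Cauchy X"
  proof (rule metric_CauchyI)
    fix e :: real assume e: "e > 0"
    obtain N where N: "inverse (real (Suc N)) < e\<^sup>2 / 4"
      using reals_Archimedean[of "e\<^sup>2 / 4"] e by auto
    have small: "J (X n) - m < e\<^sup>2 / 4" if "n \<ge> N" for n
    proof -
      have "inverse (real (Suc n)) \<le> inverse (real (Suc N))" using that by simp
      then show ?thesis using X[of n] N by linarith
    qed
    show "\<exists>N. \<forall>m\<ge>N. \<forall>n\<ge>N. dist (X m) (X n) < e"
    proof (intro exI allI impI)
      fix k n assume "N \<le> k" "N \<le> n"
      then have "(norm (X k - X n))\<^sup>2 < e\<^sup>2"
        using para[of "X k" "X n"] small[OF \<open>N \<le> k\<close>] small[OF \<open>N \<le> n\<close>] by argo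
      then show "dist (X k) (X n) < e"
        using e by (simp add: dist_norm power_less_imp_less_base)
    qed
  qed
  then obtain z where z: "X \<longlonglongrightarrow> z"
    using Cauchy_convergent convergent_def by blast
  have "(\<lambda>n. J (X n)) \<longlonglongrightarrow> J z"
    unfolding J_def by (intro tendsto_intros z f.tendsto)
  moreover have "(\<lambda>n. m + inverse (real (Suc n))) \<longlonglongrightarrow> m + 0"
    by (intro tendsto_intros LIMSEQ_inverse_real_of_nat)
  ultimately have Jz: "J z \<le> m"
    using LIMSEQ_le[of "\<lambda>n. J (X n)" "J z" "\<lambda>n. m + inverse (real (Suc n))" "m + 0"] X
    by (auto intro: less_imp_le)
  have "f y = Re (cinner z y)" for y
  proof (rule ccontr)
    assume ne: "f y \<noteq> Re (cinner z y)"
    define d where "d = Re (cinner z y) - f y"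
    \<comment> \<open>Minimality of \<open>z\<close> along the line
      \<open>z + t *\<^sub>R y\<close>; a nonzero linear coefficient \<open>d\<close> will
      contradict it.\<close>
    have quad: "0 \<le> 2 * t * d + t\<^sup>2 * (norm y)\<^sup>2" for t
    proof -
      have "J z \<le> J (z + t *\<^sub>R y)" using Jz m_le[of "z + t *\<^sub>R y"] by linarith
      then show ?thesis
        by (simp add: J_def norm_add_power2 f.add f.scaleR cinner_simps d_def power_mult_distrib
            algebra_simps)
    qed
    have y: "norm y > 0" using ne by (auto simp: f.zero cinner_simps)
    \<comment> \<open>The chosen \<open>t\<close> is the vertex of the parabola in
      \<open>quad\<close>.\<close>
    have "0 \<le> - (d\<^sup>2 / (norm y)\<^sup>2)"
      using quad[of "- d / (norm y)\<^sup>2"] y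
      by (simp add: field_simps power2_eq_square)
    then show False using y ne by (simp add: d_def field_simps)
  qed
  then show ?thesis by blast
qed

lemma cinner_eqI:
  assumes "\<And>y. Re (cinner (a::'a::complex_hilbert) y) = Re (cinner b y)" shows "a = b"
proof -
  have "Re (cinner (a - b) (a - b)) = 0" by (simp add: cinner_diff_left assms)
  then show ?thesis by (simp add: cinner_self)
qed

text \<open>Riesz in the second argument yields a real-linear \<open>A\<close>. Invariance of
  \<open>B\<close> under multiplying both arguments by \<open>\<i>\<close> is what makes
  \<open>A\<close> commute with \<open>\<i>\<close>, hence complex linear.\<close>

lemma bounded_bilinear_operator:
  fixes B :: "'a::complex_hilbert \<Rightarrow> 'a \<Rightarrow> real"
  assumes B: "bounded_bilinear B" and i: "\<And>x y. B (\<i> *\<^sub>C x) (\<i> *\<^sub>C y) = B x y"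
  shows "\<exists>A\<in>bounded_operators. \<forall>x y. Re (cinner (A x) y) = B x y"
proof -
  interpret B: bounded_bilinear B by fact
  have "\<forall>x. \<exists>z. \<forall>y. B x y = Re (cinner z y)"
    using riesz_representation_real[OF B.bounded_linear_right] by blast
  then obtain A where A: "\<And>x y. Re (cinner (A x) y) = B x y" by metis
  obtain K where K: "K > 0" "\<And>x y. norm (B x y) \<le> norm x * norm y * K"
    using B.pos_bounded by blast
  have add: "A (x + y) = A x + A y" for x y
    by (rule cinner_eqI) (simp add: A cinner_simps B.add_left)
  have real: "A (r *\<^sub>R x) = r *\<^sub>R A x" for r x
    by (rule cinner_eqI) (simp add: A cinner_simps B.scaleR_left)
  have imag: "A (\<i> *\<^sub>C x) = \<i> *\<^sub>C A x" for x
  proof (rule cinner_eqI)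
    fix y
    have "B (\<i> *\<^sub>C x) y = B (\<i> *\<^sub>C \<i> *\<^sub>C x) (\<i> *\<^sub>C y)" by (simp add: i)
    also have "\<dots> = - B x (\<i> *\<^sub>C y)"
      by (simp add: scaleC_scaleC scaleC_minus_left scaleC_one B.minus_left)
    also have "\<dots> = Re (cinner (\<i> *\<^sub>C A x) y)" by (simp add: A[symmetric] cinner_simps)
    finally show "Re (cinner (A (\<i> *\<^sub>C x)) y) = Re (cinner (\<i> *\<^sub>C A x) y)" by (simp add: A)
  qed
  have split: "c *\<^sub>C x = Re c *\<^sub>R x + Im c *\<^sub>R \<i> *\<^sub>C x" for c and x :: 'a
    by (simp add: scaleR_scaleC scaleC_scaleC scaleC_add_left[symmetric] complex_eq[symmetric] mult.commute)
  have "A \<in> bounded_operators"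
  proof (rule bounded_operators_I)
    show "A (c *\<^sub>C x) = c *\<^sub>C A x" for c x
      using split[of c x] split[of c "A x"] by (simp only: add real imag)
    show "norm (A x) \<le> norm x * K" for x
    proof (cases "A x = 0")
      case True
      with K(1) show ?thesis by simp
    next
      case False
      have "norm (A x) * norm (A x) = B x (A x)"
        by (simp add: A[symmetric] cinner_self power2_eq_square)
      also have "\<dots> \<le> (norm x * K) * norm (A x)" using K(2)[of x "A x"] by (simp add: ac_simps)
      finally show ?thesis using False by simp
    qed
  qed (rule add)
  with A show ?thesis by blast
qed

lemma adjoint_exists:
  fixes T :: "'a::complex_hilbert \<Rightarrow> 'a"
  assumes T: "T \<in> bounded_operators"
  shows "\<exists>S\<in>bounded_operators. \<forall>x y. cinner (S x) y = cinner x (T y)"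
proof -
  interpret T: bounded_linear T using T by (simp add: bounded_operators_def)
  have scale: "T (c *\<^sub>C x) = c *\<^sub>C T x" for c x using T by (simp add: bounded_operators_def)
  obtain K where K: "\<And>x. norm (T x) \<le> norm x * K" using T.bounded by blast
  have "bounded_bilinear (\<lambda>x y. Re (cinner x (T y)))"
  proof
    show "\<exists>K. \<forall>a b. norm (Re (cinner a (T b))) \<le> norm a * norm b * K"
    proof (intro exI allI)
      fix a b
      have "norm (Re (cinner a (T b))) \<le> norm a * norm (T b)"
        using abs_Re_le_cmod cmod_cinner_le order_trans by (metis real_norm_def)
      also have "\<dots> \<le> norm a * (norm b * K)" by (intro mult_left_mono K) simp
      finally show "norm (Re (cinner a (T b))) \<le> norm a * norm b * K" by (simp add: ac_simps)
    qed
  qed (simp_all add: cinner_simps T.add T.scaleR)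
  then obtain S where S: "S \<in> bounded_operators" "\<And>x y. Re (cinner (S x) y) = Re (cinner x (T y))"
    using bounded_bilinear_operator[of "\<lambda>x y. Re (cinner x (T y))"]
    by (auto simp: scale cinner_simps)
  \<comment> \<open>So far only real parts agree; replacing \<open>y\<close> by
    \<open>\<i> *\<^sub>C y\<close> recovers the imaginary parts.\<close>
  have "cinner (S x) y = cinner x (T y)" for x y
    using S(2)[of x y] S(2)[of x "\<i> *\<^sub>C y"] by (simp add: scale cinner_simps complex_eq_iff)
  with S(1) show ?thesis by blast
qed

subsection \<open>Quadratic forms and states\<close>

text \<open>Cauchy's functional equation. The defect \<open>f r - r * f 1\<close> is additive and
  vanishes at integers, so \<open>n\<close> times it equals the defect at the fractional part of
  \<open>n * r\<close>, which is bounded uniformly in \<open>n\<close>.\<close>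

lemma additive_bounded_real:
  fixes f :: "real \<Rightarrow> real"
  assumes add: "\<And>r s. f (r + s) = f r + f s" and bd: "\<And>r. \<bar>r\<bar> \<le> 1 \<Longrightarrow> \<bar>f r\<bar> \<le> M"
  shows "f r = r * f 1"
proof (rule ccontr)
  have zero: "f 0 = 0" using add[of 0 0] by simp
  have minus: "f (- s) = - f s" for s using add[of s "- s"] zero by simp
  have mult: "f (real n * s) = real n * f s" for n s
    by (induction n) (simp_all add: zero add distrib_right)
  have int: "f (of_int k) = of_int k * f 1" for k
  proof (cases k)
    case (nonneg n)
    then show ?thesis using mult[of n 1] by simp
  next
    case (neg n)
    then have "real_of_int k = - real (Suc n)" by simp
    then show ?thesis using mult[of "Suc n" 1] minus[of "real (Suc n)"]
      by (simp only: mult_minus_left mult_1_right)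
  qed
  assume ne: "f r \<noteq> r * f 1"
  then have "\<bar>f r - r * f 1\<bar> > 0" by simp
  then obtain n where n: "M + \<bar>f 1\<bar> < real n * \<bar>f r - r * f 1\<bar>"
    using reals_Archimedean3 by blast
  define s where "s = frac (real n * r)"
  have s: "0 \<le> s" "s < 1" unfolding s_def by (simp_all add: frac_lt_1)
  have nr: "real n * r = of_int \<lfloor>real n * r\<rfloor> + s" by (simp add: s_def frac_def)
  have "real n * f r = f (of_int \<lfloor>real n * r\<rfloor> + s)" using mult[of n r] nr by simp
  also have "\<dots> = of_int \<lfloor>real n * r\<rfloor> * f 1 + f s" by (simp only: add int)
  also have "of_int \<lfloor>real n * r\<rfloor> = real n * r - s" using nr by simp
  finally have "real n * (f r - r * f 1) = f s - s * f 1" by (simp add: algebra_simps)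
  then have "real n * \<bar>f r - r * f 1\<bar> = \<bar>f s - s * f 1\<bar>"
    by (metis abs_mult abs_of_nat)
  also have "\<dots> \<le> \<bar>f s\<bar> + \<bar>s\<bar> * \<bar>f 1\<bar>" by (simp add: abs_mult[symmetric])
  also have "\<dots> \<le> M + 1 * \<bar>f 1\<bar>"
    using s by (intro add_mono bd mult_right_mono) auto
  finally show False using n by simp
qed

text \<open>Polarisation of a form obeying the parallelogram law. The bound by
  \<open>(norm x)\<^sup>2\<close> supplies the local boundedness that
  \<open>additive_bounded_real\<close> needs to upgrade additivity to real homogeneity.\<close>

lemma jordan_von_neumann:
  fixes q :: "'a::complex_hilbert \<Rightarrow> real"
  assumes nonneg: "\<And>x. 0 \<le> q x" and le: "\<And>x. q x \<le> (norm x)\<^sup>2"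
    and para: "\<And>x y. q (x + y) + q (x - y) = 2 * q x + 2 * q y"
    and scale: "\<And>c x. q (c *\<^sub>C x) = (cmod c)\<^sup>2 * q x"
  shows "\<exists>A\<in>bounded_operators. \<forall>x. cinner (A x) x = of_real (q x)"
proof -
  define B where "B x y = (q (x + y) - q x - q y) / 2" for x y
  have scaleR: "q (r *\<^sub>R x) = r\<^sup>2 * q x" for r x
    by (simp add: scaleR_scaleC scale)
  have q0: "q 0 = 0" using le[of 0] nonneg[of 0] by simp
  have qm: "q (- x) = q x" for x using scaleR[of "-1" x] by simp
  \<comment> \<open>Four parallelogram identities combine to Frechet's identity, which is additivity
    of \<open>B\<close> in its first argument.\<close>
  have frechet: "q (x + y + z) = q (x + y) + q (y + z) + q (x + z) - q x - q y - q z" for x y z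
    using para[of "x + y" z] para[of "x - z" y] para[of x "y + z"] para[of x z]
    by (simp add: algebra_simps)
  have sym: "B x y = B y x" for x y by (simp add: B_def add.commute)
  have add: "B (x + y) z = B x z + B y z" for x y z
    using frechet[of x y z] by (simp add: B_def field_simps)
  have B4: "B x y = (q (x + y) - q (x - y)) / 4" for x y
    using para[of x y] by (simp add: B_def)
  have bound: "\<bar>B x y\<bar> \<le> (norm x + norm y)\<^sup>2 / 4" for x y
  proof -
    have "q (x + y) \<le> (norm x + norm y)\<^sup>2"
      by (rule order_trans[OF le]) (intro power_mono norm_triangle_ineq norm_ge_zero)
    moreover have "q (x - y) \<le> (norm x + norm y)\<^sup>2"
      by (rule order_trans[OF le]) (intro power_mono norm_triangle_ineq4 norm_ge_zero)
    ultimately show ?thesis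
      using nonneg[of "x + y"] nonneg[of "x - y"] by (auto simp: B4 abs_le_iff)
  qed
  have homogeneous: "B (r *\<^sub>R x) y = r * B x y" for r x y
  proof -
    \<comment> \<open>Writing \<open>x\<close> as \<open>1 *\<^sub>R x\<close> gives the right-hand
      side the shape \<open>r * f 1\<close>.\<close>
    have "B (r *\<^sub>R x) y = r * B (1 *\<^sub>R x) y"
    proof (rule additive_bounded_real)
      show "B ((r + s) *\<^sub>R x) y = B (r *\<^sub>R x) y + B (s *\<^sub>R x) y" for r s
        by (simp add: scaleR_add_left add)
      show "\<bar>B (r *\<^sub>R x) y\<bar> \<le> (norm x + norm y)\<^sup>2 / 4" if "\<bar>r\<bar> \<le> 1" for r
      proof -
        have "(norm (r *\<^sub>R x) + norm y)\<^sup>2 \<le> (norm x + norm y)\<^sup>2"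
          using that by (intro power_mono add_mono) (auto intro: mult_left_le_one_le)
        then show ?thesis using bound[of "r *\<^sub>R x" y] by linarith
      qed
    qed
    then show ?thesis by simp
  qed
  have "bounded_bilinear B"
  proof
    show "B a (b + c) = B a b + B a c" for a b c using add sym by metis
    show "B a (r *\<^sub>R b) = r *\<^sub>R B a b" for r a b using homogeneous sym by (metis real_scaleR_def)
    show "\<exists>K. \<forall>a b. norm (B a b) \<le> norm a * norm b * K"
    proof (intro exI allI)
      fix a b
      show "norm (B a b) \<le> norm a * norm b * 1"
      proof (cases "a = 0 \<or> b = 0")
        case True
        then show ?thesis by (auto simp: B_def q0)
      next
        case False
        \<comment> \<open>Rescaling to unit vectors, where \<open>bound\<close> reads
          \<open>(1 + 1)\<^sup>2 / 4 = 1\<close>.\<close>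
        have "B a b = B (norm a *\<^sub>R sgn a) (norm b *\<^sub>R sgn b)"
          using False by (simp add: sgn_div_norm)
        also have "\<dots> = (norm a * norm b) * B (sgn a) (sgn b)"
          using homogeneous sym by (metis mult.assoc)
        finally have "norm (B a b) = (norm a * norm b) * \<bar>B (sgn a) (sgn b)\<bar>"
          by (simp add: abs_mult)
        also have "\<dots> \<le> (norm a * norm b) * 1"
          using bound[of "sgn a" "sgn b"] False by (intro mult_left_mono) (auto simp: norm_sgn)
        finally show ?thesis by simp
      qed
    qed
  qed (simp_all add: add homogeneous)
  moreover have "B (\<i> *\<^sub>C x) (\<i> *\<^sub>C y) = B x y" for x y
    by (simp add: B_def scaleC_add_right[symmetric] scale)
  ultimately obtain A where A: "A \<in> bounded_operators" "\<And>x y. Re (cinner (A x) y) = B x y"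
    using bounded_bilinear_operator by blast
  have "cinner (A x) x = of_real (q x)" for x
  proof (rule complex_eqI)
    have "q (2 *\<^sub>R x) = 4 * q x" by (simp only: scaleR) simp
    then show "Re (cinner (A x) x) = Re (of_real (q x))"
      by (simp add: A B_def scaleR_2)
    \<comment> \<open>Since \<open>(cmod (1 + \<i>))\<^sup>2 = 2\<close>,
      \<open>B x (\<i> *\<^sub>C x)\<close> vanishes, and it equals the imaginary part of
      \<open>cinner (A x) x\<close>.\<close>
    have "x + \<i> *\<^sub>C x = (1 + \<i>) *\<^sub>C x" by (simp add: scaleC_add_left scaleC_one)
    then have "B x (\<i> *\<^sub>C x) = 0" by (simp add: B_def scale cmod_power2)
    then show "Im (cinner (A x) x) = Im (of_real (q x))"
      using A(2)[of x "\<i> *\<^sub>C x"] by (simp add: cinner_simps)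
  qed
  with A(1) show ?thesis by blast
qed

section \<open>States and the numerical radius\<close>

text \<open>Vanishing imaginary parts at \<open>u = 1\<close> and \<open>u = \<i>\<close> force
  \<open>r = cnj p\<close>. Rotating \<open>p\<close> onto the negative real axis then leaves
  \<open>c - 2 * cmod p\<close> as a nonnegative value.\<close>

lemma rotation_nonneg:
  assumes nn: "\<And>u. cmod u = 1 \<Longrightarrow> complex_of_real c + u * p + cnj u * r \<in> \<real>\<^sub>\<ge>\<^sub>0"
  shows "r = cnj p" and "2 * cmod p \<le> c"
proof -
  show r: "r = cnj p"
    using nn[of 1] nn[of \<i>] by (simp add: complex_eq_iff complex_nonneg_Reals_iff)
  show "2 * cmod p \<le> c"
  proof (cases "p = 0")
    case True
    then show ?thesis using nn[of 1] r by (simp add: complex_nonneg_Reals_iff)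
  next
    case False
    define u where "u = - cnj (sgn p)"
    have "cmod u = 1" using False by (simp add: u_def norm_sgn)
    moreover have "u * p = - of_real (cmod p)"
      using False by (simp add: u_def sgn_eq complex_norm_square[symmetric] power2_eq_square mult.commute)
    moreover from this have "cnj u * r = - of_real (cmod p)"
      unfolding r by (metis complex_cnj_complex_of_real complex_cnj_minus complex_cnj_mult)
    ultimately show ?thesis using nn[of u] by (simp add: complex_nonneg_Reals_iff)
  qed
qed

text \<open>\<open>f\<close> maps the given positive operators to the numbers in
  \<open>rotation_nonneg\<close>. \<open>S\<close> takes the place of the adjoint of
  \<open>T\<close>. The lemma serves both to bound states and to bound the radius when
  \<open>T\<close> comes from a completely positive map.\<close>

lemma state_bound:
  fixes T :: "'a::complex_hilbert \<Rightarrow> 'a"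
  assumes f: "state f" and T: "T \<in> bounded_operators" and S: "S \<in> bounded_operators"
    and pos: "\<And>u. cmod u = 1 \<Longrightarrow>
      positive_operator (\<lambda>x. c *\<^sub>R x + (u *\<^sub>C T x + cnj u *\<^sub>C S x))"
  shows "2 * cmod (f T) \<le> c"
proof (rule rotation_nonneg(2)[where p = "f T" and r = "f S"])
  fix u :: complex assume "cmod u = 1"
  from pos[OF this] have "f (\<lambda>x. c *\<^sub>R x + (u *\<^sub>C T x + cnj u *\<^sub>C S x)) \<in> \<real>\<^sub>\<ge>\<^sub>0"
    using f by (auto simp: state_def)
  also have "f (\<lambda>x. c *\<^sub>R x + (u *\<^sub>C T x + cnj u *\<^sub>C S x))
      = of_real c + (u * f T + cnj u * f S)"
  proof -
    have add: "f (\<lambda>x. U x + V x) = f U + f V"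
      if "U \<in> bounded_operators" "V \<in> bounded_operators" for U V
      using f that by (simp add: state_def)
    have scale: "f (\<lambda>x. a *\<^sub>C U x) = a * f U" if "U \<in> bounded_operators" for a U
      using f that by (simp add: state_def)
    note B = bounded_operators_scaleC T S bounded_operators_id bounded_operators_add
    have "f (\<lambda>x. of_real c *\<^sub>C x + (u *\<^sub>C T x + cnj u *\<^sub>C S x))
        = f (\<lambda>x. of_real c *\<^sub>C x) + f (\<lambda>x. u *\<^sub>C T x + cnj u *\<^sub>C S x)"
      by (intro add B)
    also have "f (\<lambda>x. u *\<^sub>C T x + cnj u *\<^sub>C S x) = f (\<lambda>x. u *\<^sub>C T x) + f (\<lambda>x. cnj u *\<^sub>C S x)"
      by (intro add B)
    also have "f (\<lambda>x. of_real c *\<^sub>C x) = of_real c"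
      using scale[OF bounded_operators_id] f by (simp add: state_def)
    finally show ?thesis by (simp add: scaleR_scaleC scale T S)
  qed
  finally show "complex_of_real c + u * f T + cnj u * f S \<in> \<real>\<^sub>\<ge>\<^sub>0" by (simp add: add.assoc)
qed

text \<open>States are defined by linearity, positivity and normalisation, so a bound on their
  values has to be derived. It makes the supremum in \<open>numerical_radius\<close> one over a
  bounded set.\<close>

lemma state_bounded:
  fixes T :: "'a::complex_hilbert \<Rightarrow> 'a"
  assumes T: "T \<in> bounded_operators"
  shows "\<exists>K. \<forall>f. state f \<longrightarrow> cmod (f T) \<le> K"
proof -
  obtain K where K: "\<And>x. norm (T x) \<le> norm x * K"
    using T bounded_linear.bounded unfolding bounded_operators_def by blast
  obtain S where S: "S \<in> bounded_operators" "\<And>x y. cinner (S x) y = cinner x (T y)"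
    using adjoint_exists[OF T] by blast
  \<comment> \<open>The factor 2 on the right pays for \<open>z + cnj z\<close>, that is, twice a
    real part of size at most \<open>K * (norm x)\<^sup>2\<close>.\<close>
  have "2 * cmod (f T) \<le> 2 * K" if "state f" for f
  proof (rule state_bound[OF that T S(1)])
    fix u :: complex assume u: "cmod u = 1"
    show "positive_operator (\<lambda>x. (2 * K) *\<^sub>R x + (u *\<^sub>C T x + cnj u *\<^sub>C S x))"
      unfolding positive_operator_def
    proof (intro conjI allI)
      show "(\<lambda>x. (2 * K) *\<^sub>R x + (u *\<^sub>C T x + cnj u *\<^sub>C S x)) \<in> bounded_operators"
        unfolding scaleR_scaleC
        by (intro bounded_operators_add bounded_operators_scaleC bounded_operators_id T S)
      fix x
      define z where "z = u * cinner (T x) x"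
      have "cinner (S x) x = cnj (cinner (T x) x)" by (metis S(2) cinner_commute)
      then have eq: "cinner ((2 * K) *\<^sub>R x + (u *\<^sub>C T x + cnj u *\<^sub>C S x)) x
          = of_real (2 * K * (norm x)\<^sup>2) + (z + cnj z)"
        by (simp add: cinner_simps cinner_self z_def)
      have "cmod z \<le> norm (T x) * norm x"
        using cmod_cinner_le[of "T x" x] by (simp add: z_def norm_mult u)
      also have "\<dots> \<le> norm x * K * norm x" by (intro mult_right_mono K) simp
      finally have "- Re z \<le> K * (norm x)\<^sup>2"
        using abs_Re_le_cmod[of z] by (simp add: power2_eq_square ac_simps)
      then show "cinner ((2 * K) *\<^sub>R x + (u *\<^sub>C T x + cnj u *\<^sub>C S x)) x \<in> \<real>\<^sub>\<ge>\<^sub>0"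
        unfolding eq by (simp add: complex_nonneg_Reals_iff)
    qed
  qed
  then show ?thesis by auto
qed

text \<open>Vector states link the numerical range, defined through states, to the inner products
  \<open>cinner (S x) x\<close>.\<close>

lemma state_vector:
  assumes "x \<noteq> (0::'a::complex_hilbert)"
  shows "state (\<lambda>S. cinner (S x) x / of_real ((norm x)\<^sup>2))"
proof -
  have "cinner (S x) x / of_real ((norm x)\<^sup>2) \<in> \<real>\<^sub>\<ge>\<^sub>0" if "positive_operator S" for S
    using that by (intro nonneg_Reals_divide_I) (auto simp: positive_operator_def)
  then show ?thesis
    using assms by (auto simp: state_def cinner_simps add_divide_distrib cinner_self)
qed

text \<open>The supremum is tested on the vector state at \<open>x\<close>;
  \<open>state_bounded\<close> supplies the upper bound that \<open>cSUP_upper\<close>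
  requires.\<close>

lemma cmod_cinner_le_numerical_radius:
  fixes T :: "'a::complex_hilbert \<Rightarrow> 'a"
  assumes T: "T \<in> bounded_operators"
  shows "cmod (cinner (T x) x) \<le> numerical_radius T * (norm x)\<^sup>2"
proof (cases "x = 0")
  case False
  obtain K where K: "\<And>f. state f \<Longrightarrow> cmod (f T) \<le> K" using state_bounded[OF T] by blast
  have "bdd_above (cmod ` insert 0 (numerical_range T))"
    by (rule bdd_aboveI2[where M = "max 0 K"]) (auto simp: numerical_range_def max.coboundedI2 dest: K)
  moreover have "cinner (T x) x / of_real ((norm x)\<^sup>2) \<in> insert 0 (numerical_range T)"
    unfolding numerical_range_def
    by (intro insertI2 CollectI exI[of _ "\<lambda>S. cinner (S x) x / of_real ((norm x)\<^sup>2)"] conjI refl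
        state_vector False)
  ultimately have "cmod (cinner (T x) x / of_real ((norm x)\<^sup>2)) \<le> numerical_radius T"
    unfolding numerical_radius_def by (rule cSUP_upper[rotated])
  then show ?thesis using False by (simp add: norm_divide norm_power field_simps)
qed (simp add: cinner_simps)

subsection \<open>The Toeplitz form\<close>

text \<open>The summand is the \<open>k\<close>-th power of a fixed \<open>N\<close>-th root of
  unity \<open>w\<close>, so the sum is geometric. As \<open>a\<close> and \<open>b\<close> are
  below \<open>N\<close>, \<open>w = 1\<close> only if they agree.\<close>

lemma sum_roots_of_unity_orthogonal:
  assumes "a < N" "b < N"
  defines "\<zeta> \<equiv> \<lambda>k. exp (2 * of_real pi * \<i> * of_nat k / of_nat N)"
  shows "(\<Sum>k<N. \<zeta> k ^ a * cnj (\<zeta> k ^ b)) = of_nat N * of_bool (a = b)"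
proof -
  define \<omega> where "\<omega> = \<zeta> 1"
  have \<zeta>: "\<zeta> k = \<omega> ^ k" for k
    by (simp add: \<omega>_def \<zeta>_def exp_of_nat_mult[symmetric] mult_ac)
  have N: "\<omega> ^ N = 1"
    using complex_root_unity[of N 1] assms by (simp add: \<omega>_def)
  have unit: "\<omega> * cnj \<omega> = 1"
    by (simp add: \<omega>_def \<zeta>_def complex_norm_square[symmetric] norm_exp_eq_Re)
  define w where "w = \<omega> ^ a * cnj (\<omega> ^ b)"
  have "\<zeta> k ^ a * cnj (\<zeta> k ^ b) = w ^ k" for k
    by (simp add: \<zeta> w_def power_mult_distrib power_mult[symmetric] mult.commute)
  then have sum: "(\<Sum>k<N. \<zeta> k ^ a * cnj (\<zeta> k ^ b)) = (\<Sum>k<N. w ^ k)" by simp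
  show ?thesis
  proof (cases "a = b")
    case True
    then have "w = 1" by (simp add: w_def power_mult_distrib[symmetric] unit)
    then show ?thesis using True sum by simp
  next
    case False
    have "w \<noteq> 1"
    proof
      assume "w = 1"
      then have "\<omega> ^ b = w * \<omega> ^ b" by simp
      also have "\<dots> = \<omega> ^ a * (\<omega> * cnj \<omega>) ^ b" by (simp add: w_def power_mult_distrib mult_ac)
      finally have "\<omega> ^ b = \<omega> ^ a" by (simp add: unit)
      then have "\<zeta> b = \<zeta> a" by (simp add: \<zeta>)
      then have "b mod N = a mod N"
        using complex_root_unity_eq[of N b a] assms by (simp add: \<zeta>_def)
      then show False using assms False by simp
    qed
    moreover have "w ^ N = 1"
    proof -
      have "w ^ N = (\<omega> ^ N) ^ a * cnj ((\<omega> ^ N) ^ b)"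
        by (simp add: w_def power_mult_distrib power_mult[symmetric] mult.commute)
      then show ?thesis by (simp add: N)
    qed
    ultimately have "(\<Sum>k<N. w ^ k) = 0" by (simp add: geometric_sum)
    then show ?thesis using False sum by simp
  qed
qed

text \<open>This is the quadratic form of the tridiagonal Toeplitz operator matrix of size
  \<open>n + 1\<close> with the identity on the diagonal, \<open>T\<close> below it and the adjoint
  of \<open>T\<close> above it.\<close>

definition toeplitz_form :: "('a::complex_hilbert \<Rightarrow> 'a) \<Rightarrow> nat \<Rightarrow> (nat \<Rightarrow> 'a) \<Rightarrow> real" where
  "toeplitz_form T n \<xi> =
    (\<Sum>i\<le>n. (norm (\<xi> i))\<^sup>2) + 2 * (\<Sum>i<n. Re (cinner (T (\<xi> i)) (\<xi> (Suc i))))"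

text \<open>The form is the average, over the \<open>(n + 2)\<close>-th roots of unity \<open>\<zeta>\<close>, of
  \<open>\<parallel>x\<parallel>\<^sup>2 + 2 Re (\<zeta> \<langle>T x, x\<rangle>)\<close> at \<open>x = \<Sum>\<^sub>j \<zeta>\<^sup>j \<xi>\<^sub>j\<close>.\<close>

lemma toeplitz_form_nonneg:
  fixes T :: "'a::complex_hilbert \<Rightarrow> 'a"
  assumes T: "T \<in> bounded_operators"
    and w: "\<And>x. 2 * cmod (cinner (T x) x) \<le> (norm x)\<^sup>2"
  shows "0 \<le> toeplitz_form T n \<xi>"
proof -
  interpret T: bounded_linear T using T by (simp add: bounded_operators_def)
  have scale: "T (c *\<^sub>C x) = c *\<^sub>C T x" for c x using T by (simp add: bounded_operators_def)
  \<comment> \<open>After a shift by \<open>p \<le> 1\<close> exponents reach \<open>n + 1\<close>;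
    with \<open>n + 2\<close> roots none of them wraps around.\<close>
  define N where "N = n + 2"
  define \<zeta> where "\<zeta> k = exp (2 * of_real pi * \<i> * of_nat k / of_nat N)" for k
  define x where "x k = (\<Sum>j\<le>n. \<zeta> k ^ j *\<^sub>C \<xi> j)" for k
  \<comment> \<open>Weighting by \<open>\<zeta> k ^ p\<close> selects one diagonal:
    \<open>p = 0\<close> gives the norms, \<open>p = 1\<close> the cross terms.\<close>
  have average: "(\<Sum>k<N. \<zeta> k ^ p * (\<Sum>i\<le>n. \<Sum>j\<le>n. \<zeta> k ^ i * (cnj (\<zeta> k ^ j) * g i j)))
      = of_nat N * (\<Sum>i\<le>n. \<Sum>j\<le>n. of_bool (i + p = j) * g i j)" if "p \<le> 1" for p g
  proof -
    have "(\<Sum>k<N. \<zeta> k ^ p * (\<Sum>i\<le>n. \<Sum>j\<le>n. \<zeta> k ^ i * (cnj (\<zeta> k ^ j) * g i j)))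
        = (\<Sum>k<N. \<Sum>i\<le>n. \<Sum>j\<le>n. \<zeta> k ^ (i + p) * cnj (\<zeta> k ^ j) * g i j)"
      by (simp add: sum_distrib_left power_add mult_ac)
    also have "\<dots> = (\<Sum>i\<le>n. \<Sum>k<N. \<Sum>j\<le>n. \<zeta> k ^ (i + p) * cnj (\<zeta> k ^ j) * g i j)"
      by (rule sum.swap)
    also have "\<dots> = (\<Sum>i\<le>n. \<Sum>j\<le>n. \<Sum>k<N. \<zeta> k ^ (i + p) * cnj (\<zeta> k ^ j) * g i j)"
      by (intro sum.cong refl sum.swap)
    also have "\<dots> = (\<Sum>i\<le>n. \<Sum>j\<le>n. of_nat N * of_bool (i + p = j) * g i j)"
    proof (intro sum.cong refl)
      fix i j assume "i \<in> {..n}" "j \<in> {..n}"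
      then have "i + p < N" "j < N" using that by (auto simp: N_def)
      from sum_roots_of_unity_orthogonal[OF this]
      show "(\<Sum>k<N. \<zeta> k ^ (i + p) * cnj (\<zeta> k ^ j) * g i j) = of_nat N * of_bool (i + p = j) * g i j"
        by (simp only: \<zeta>_def sum_distrib_right[symmetric])
    qed
    finally show ?thesis by (simp only: sum_distrib_left mult.assoc)
  qed
  have delta: "(\<Sum>j\<le>n. of_bool (k = j) * h j) = of_bool (k \<le> n) * h k" for k and h :: "nat \<Rightarrow> complex"
  proof -
    have "(\<Sum>j\<le>n. of_bool (k = j) * h j) = (\<Sum>j\<le>n. if k = j then h j else 0)"
      by (intro sum.cong) auto
    then show ?thesis by simp
  qed
  have expand: "cinner (\<Sum>i\<le>n. \<zeta> k ^ i *\<^sub>C g i) (x k)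
      = (\<Sum>i\<le>n. \<Sum>j\<le>n. \<zeta> k ^ i * (cnj (\<zeta> k ^ j) * cinner (g i) (\<xi> j)))" for k g
    by (simp only: x_def cinner_sum_left cinner_scaleC_left)
      (simp only: cinner_sum_right cinner_scaleC_right sum_distrib_left)
  have Tx: "T (x k) = (\<Sum>i\<le>n. \<zeta> k ^ i *\<^sub>C T (\<xi> i))" for k
    by (simp only: x_def T.sum scale)
  have "(\<Sum>k<N. cinner (x k) (x k)) = of_nat N * (\<Sum>i\<le>n. \<Sum>j\<le>n. of_bool (i + 0 = j) * cinner (\<xi> i) (\<xi> j))"
    using average[of 0 "\<lambda>i j. cinner (\<xi> i) (\<xi> j)"]
    by (simp only: expand[of _ \<xi>, folded x_def] power_0 mult_1 le_numeral_extra)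
  also have "\<dots> = of_nat N * (\<Sum>i\<le>n. cinner (\<xi> i) (\<xi> i))"
    by (simp only: delta) simp
  finally have "complex_of_real (\<Sum>k<N. (norm (x k))\<^sup>2) = complex_of_real (real N * (\<Sum>i\<le>n. (norm (\<xi> i))\<^sup>2))"
    by (simp add: cinner_self)
  then have norms: "(\<Sum>k<N. (norm (x k))\<^sup>2) = real N * (\<Sum>i\<le>n. (norm (\<xi> i))\<^sup>2)"
    by (simp only: of_real_eq_iff)
  have "(\<Sum>k<N. \<zeta> k * cinner (T (x k)) (x k))
      = of_nat N * (\<Sum>i\<le>n. \<Sum>j\<le>n. of_bool (i + 1 = j) * cinner (T (\<xi> i)) (\<xi> j))"
    using average[of 1 "\<lambda>i j. cinner (T (\<xi> i)) (\<xi> j)"]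
    by (simp only: Tx expand power_one_right)
  \<comment> \<open>The index \<open>i = n\<close> has its partner \<open>n + 1\<close> out of range
    and drops out, leaving the range of the cross terms in \<open>toeplitz_form\<close>.\<close>
  also have "\<dots> = of_nat N * (\<Sum>i\<le>n. of_bool (i < n) * cinner (T (\<xi> i)) (\<xi> (Suc i)))"
    by (simp only: delta Suc_eq_plus1[symmetric] Suc_le_eq)
  also have "\<dots> = of_nat N * (\<Sum>i<n. cinner (T (\<xi> i)) (\<xi> (Suc i)))"
    by (simp add: lessThan_Suc_atMost[symmetric])
  finally have cross: "(\<Sum>k<N. \<zeta> k * cinner (T (x k)) (x k)) = of_nat N * (\<Sum>i<n. cinner (T (\<xi> i)) (\<xi> (Suc i)))" .
  have "0 \<le> (\<Sum>k<N. (norm (x k))\<^sup>2 + 2 * Re (\<zeta> k * cinner (T (x k)) (x k)))"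
  proof (rule sum_nonneg)
    fix k
    have "cmod (\<zeta> k) = 1" by (simp add: \<zeta>_def norm_exp_eq_Re)
    then have "2 * cmod (\<zeta> k * cinner (T (x k)) (x k)) \<le> (norm (x k))\<^sup>2"
      using w[of "x k"] by (simp add: norm_mult)
    then show "0 \<le> (norm (x k))\<^sup>2 + 2 * Re (\<zeta> k * cinner (T (x k)) (x k))"
      using abs_Re_le_cmod[of "\<zeta> k * cinner (T (x k)) (x k)"] by linarith
  qed
  also have "\<dots> = (\<Sum>k<N. (norm (x k))\<^sup>2) + 2 * Re (\<Sum>k<N. \<zeta> k * cinner (T (x k)) (x k))"
    by (simp only: sum.distrib sum_distrib_left[symmetric] Re_sum)
  also have "\<dots> = real N * toeplitz_form T n \<xi>"
    unfolding norms cross by (simp add: toeplitz_form_def distrib_left)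
  finally show ?thesis by (simp add: zero_le_mult_iff N_def)
qed

text \<open>Padding by zeros adds neither squares nor cross terms, so sequences of different lengths
  can be brought to a common length.\<close>

lemma toeplitz_form_truncate:
  assumes "n \<le> m"
  shows "toeplitz_form T m (\<lambda>i. if i \<le> n then \<xi> i else 0) = toeplitz_form T n \<xi>"
proof -
  let ?\<xi> = "\<lambda>i. if i \<le> n then \<xi> i else 0"
  have "(\<Sum>i\<le>m. (norm (?\<xi> i))\<^sup>2) = (\<Sum>i\<le>n. (norm (\<xi> i))\<^sup>2)"
    using \<open>n \<le> m\<close> by (intro sum.mono_neutral_cong_right) auto
  moreover have "(\<Sum>i<m. Re (cinner (T (?\<xi> i)) (?\<xi> (Suc i)))) = (\<Sum>i<n. Re (cinner (T (\<xi> i)) (\<xi> (Suc i))))"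
    using \<open>n \<le> m\<close> by (intro sum.mono_neutral_cong_right) (auto simp: cinner_simps)
  ultimately show ?thesis by (simp add: toeplitz_form_def)
qed

lemma toeplitz_form_parallelogram:
  assumes T: "T \<in> bounded_operators"
  shows "toeplitz_form T n (\<lambda>i. \<xi> i + \<eta> i) + toeplitz_form T n (\<lambda>i. \<xi> i - \<eta> i)
    = 2 * toeplitz_form T n \<xi> + 2 * toeplitz_form T n \<eta>"
proof -
  interpret T: bounded_linear T using T by (simp add: bounded_operators_def)
  show ?thesis
    by (simp add: toeplitz_form_def norm_add_power2 norm_diff_power2 T.add T.diff cinner_simps
        sum.distrib sum_subtractf)
qed

lemma toeplitz_form_scaleC:
  assumes T: "T \<in> bounded_operators"
  shows "toeplitz_form T n (\<lambda>i. c *\<^sub>C \<xi> i) = (cmod c)\<^sup>2 * toeplitz_form T n \<xi>"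
proof -
  have "Re (cinner (T (c *\<^sub>C x)) (c *\<^sub>C y)) = (cmod c)\<^sup>2 * Re (cinner (T x) y)" for x y
  proof -
    have "cinner (T (c *\<^sub>C x)) (c *\<^sub>C y) = (c * cnj c) * cinner (T x) y"
      using T by (simp add: bounded_operators_def cinner_simps)
    also have "c * cnj c = of_real ((cmod c)\<^sup>2)" by (rule complex_norm_square[symmetric])
    finally show ?thesis by simp
  qed
  then show ?thesis
    by (simp add: toeplitz_form_def norm_scaleC power_mult_distrib sum_distrib_left distrib_left mult_ac)
qed

lemma toeplitz_form_Cons:
  "toeplitz_form T (Suc n) (case_nat x \<xi>) = (norm x)\<^sup>2 + 2 * Re (cinner (T x) (\<xi> 0)) + toeplitz_form T n \<xi>"
  by (simp add: toeplitz_form_def sum.atMost_Suc_shift sum.lessThan_Suc_shift del: sum.atMost_Suc sum.lessThan_Suc)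

text \<open>The quadratic form \<open>q x\<close> is the infimum of the Toeplitz form over all finite sequences
  starting with \<open>x\<close>; prepending \<open>x\<close> to a sequence that starts with \<open>y\<close> gives the last claim.\<close>

lemma toeplitz_schur_complement:
  fixes T :: "'a::complex_hilbert \<Rightarrow> 'a"
  assumes T: "T \<in> bounded_operators"
    and w: "\<And>x. 2 * cmod (cinner (T x) x) \<le> (norm x)\<^sup>2"
  obtains q where "\<And>x. 0 \<le> q x" "\<And>x. q x \<le> (norm x)\<^sup>2"
    "\<And>x y. q (x + y) + q (x - y) = 2 * q x + 2 * q y"
    "\<And>c x. q (c *\<^sub>C x) = (cmod c)\<^sup>2 * q x"
    "\<And>x y. q x \<le> (norm x)\<^sup>2 + 2 * Re (cinner (T x) y) + q y"
proof
  define V where "V x = {toeplitz_form T n \<xi> | n \<xi>. \<xi> 0 = x}" for x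
  define q where "q x = Inf (V x)" for x
  have V0: "0 \<le> v" if "v \<in> V x" for v x
    using that toeplitz_form_nonneg[OF T w] by (auto simp: V_def)
  \<comment> \<open>The one-term sequence \<open>x\<close>; it gives both nonemptiness of
    \<open>V x\<close> and the upper bound on \<open>q x\<close>.\<close>
  have norm_V: "(norm x)\<^sup>2 \<in> V x" for x
    unfolding V_def
    by (intro CollectI exI[of _ 0] exI[of _ "\<lambda>_. x"]) (simp add: toeplitz_form_def)
  have ne: "V x \<noteq> {}" for x using norm_V by blast
  have bdd: "bdd_below (V x)" for x using V0 by (intro bdd_belowI)
  have lower: "q x \<le> toeplitz_form T n \<xi>" if "\<xi> 0 = x" for x n \<xi>
    unfolding q_def by (rule cInf_lower[OF _ bdd]) (use that in \<open>auto simp: V_def\<close>)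
  have greatest: "c \<le> q x" if "\<And>n \<xi>. \<xi> 0 = x \<Longrightarrow> c \<le> toeplitz_form T n \<xi>" for c x
    unfolding q_def by (rule cInf_greatest[OF ne]) (use that in \<open>auto simp: V_def\<close>)
  have approx: "\<exists>n \<xi>. \<xi> 0 = x \<and> toeplitz_form T n \<xi> < q x + e" if "e > 0" for x e
    using cInf_lessD[OF ne, of x "q x + e"] that by (auto simp: q_def V_def)
  show "0 \<le> q x" for x by (rule greatest) (rule toeplitz_form_nonneg[OF T w])
  show "q x \<le> (norm x)\<^sup>2" for x unfolding q_def by (rule cInf_lower[OF norm_V bdd])
  have scale_le: "q (c *\<^sub>C x) \<le> (cmod c)\<^sup>2 * q x" if "c \<noteq> 0" for c x
  proof -
    have "q (c *\<^sub>C x) / (cmod c)\<^sup>2 \<le> q x"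
    proof (rule greatest)
      fix n and \<xi> :: "nat \<Rightarrow> 'a" assume "\<xi> 0 = x"
      then show "q (c *\<^sub>C x) / (cmod c)\<^sup>2 \<le> toeplitz_form T n \<xi>"
        using lower[of "\<lambda>i. c *\<^sub>C \<xi> i" "c *\<^sub>C x" n] that
        by (simp add: toeplitz_form_scaleC[OF T] field_simps)
    qed
    then show ?thesis using that by (simp add: field_simps)
  qed
  show scale: "q (c *\<^sub>C x) = (cmod c)\<^sup>2 * q x" for c x
  proof (cases "c = 0")
    case True
    have "q 0 = 0" using lower[of "\<lambda>_. 0" 0 0] \<open>\<And>x. 0 \<le> q x\<close>[of 0]
      by (simp add: toeplitz_form_def)
    then show ?thesis using True by (simp add: scaleC_zero_left)
  next
    case False
    \<comment> \<open>Scaling back by \<open>inverse c\<close> reverses the inequality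
      \<open>scale_le\<close>.\<close>
    have "q x \<le> (cmod (inverse c))\<^sup>2 * q (c *\<^sub>C x)"
      using scale_le[of "inverse c" "c *\<^sub>C x"] False by (simp add: scaleC_scaleC scaleC_one)
    then have "(cmod c)\<^sup>2 * q x \<le> q (c *\<^sub>C x)"
      using False by (simp add: norm_divide power_divide field_simps)
    with scale_le[OF False, of x] show ?thesis by simp
  qed
  have para_le: "q (x + y) + q (x - y) \<le> 2 * q x + 2 * q y" for x y
  proof (rule field_le_epsilon)
    fix e :: real assume "e > 0"
    \<comment> \<open>Slack \<open>e / 4\<close> suffices because each of the two near-optimal
      values is doubled in the parallelogram law.\<close>
    then obtain n \<xi> m \<eta> where \<xi>: "\<xi> 0 = x" "toeplitz_form T n \<xi> < q x + e / 4"
      and \<eta>: "\<eta> 0 = y" "toeplitz_form T m \<eta> < q y + e / 4"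
      using approx[of "e / 4"] by (meson divide_pos_pos zero_less_numeral)
    define N where "N = max n m"
    define \<xi>' where "\<xi>' i = (if i \<le> n then \<xi> i else 0)" for i
    define \<eta>' where "\<eta>' i = (if i \<le> m then \<eta> i else 0)" for i
    have "toeplitz_form T N \<xi>' = toeplitz_form T n \<xi>" "toeplitz_form T N \<eta>' = toeplitz_form T m \<eta>"
      unfolding \<xi>'_def \<eta>'_def by (simp_all add: toeplitz_form_truncate N_def)
    moreover have "q (x + y) \<le> toeplitz_form T N (\<lambda>i. \<xi>' i + \<eta>' i)"
      "q (x - y) \<le> toeplitz_form T N (\<lambda>i. \<xi>' i - \<eta>' i)"
      using \<xi> \<eta> by (intro lower; simp add: \<xi>'_def \<eta>'_def)+
    ultimately show "q (x + y) + q (x - y) \<le> 2 * q x + 2 * q y + e"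
      using toeplitz_form_parallelogram[OF T, of N \<xi>' \<eta>'] \<xi>(2) \<eta>(2) by linarith
  qed
  show "q (x + y) + q (x - y) = 2 * q x + 2 * q y" for x y
  \<comment> \<open>For the reverse inequality, \<open>para_le\<close> is applied to
    \<open>x + y\<close> and \<open>x - y\<close>, whose sum and difference are
    \<open>2 *\<^sub>R x\<close> and \<open>2 *\<^sub>R y\<close>.\<close>
  proof (rule antisym[OF para_le])
    have "q (2 *\<^sub>R z) = 4 * q z" for z by (simp only: scaleR_scaleC scale) simp
    moreover have "(x + y) + (x - y) = 2 *\<^sub>R x" "(x + y) - (x - y) = 2 *\<^sub>R y"
      by (simp_all add: scaleR_2)
    ultimately show "2 * q x + 2 * q y \<le> q (x + y) + q (x - y)"
      using para_le[of "x + y" "x - y"] by simp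
  qed
  show "q x \<le> (norm x)\<^sup>2 + 2 * Re (cinner (T x) y) + q y" for x y
  proof -
    have "q x - (norm x)\<^sup>2 - 2 * Re (cinner (T x) y) \<le> q y"
    proof (rule greatest)
      fix n and \<xi> :: "nat \<Rightarrow> 'a" assume "\<xi> 0 = y"
      then show "q x - (norm x)\<^sup>2 - 2 * Re (cinner (T x) y) \<le> toeplitz_form T n \<xi>"
        using lower[of "case_nat x \<xi>" x "Suc n"] by (simp add: toeplitz_form_Cons)
    qed
    then show ?thesis by simp
  qed
qed

subsection \<open>Positive kernels\<close>

text \<open>Positive semidefinite scalar matrices. The index set is arbitrary so that a pair of
  block number and coordinate can serve as one index.\<close>

definition positive_kernel :: "'i set \<Rightarrow> ('i \<Rightarrow> 'i \<Rightarrow> complex) \<Rightarrow> bool" where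
  "positive_kernel I a \<longleftrightarrow> (\<forall>z. (\<Sum>i\<in>I. \<Sum>j\<in>I. a i j * z j * cnj (z i)) \<in> \<real>\<^sub>\<ge>\<^sub>0)"

lemma positive_kernel_subset:
  assumes "positive_kernel I a" "J \<subseteq> I" "finite I"
  shows "positive_kernel J a"
  unfolding positive_kernel_def
proof
  fix z :: "'a \<Rightarrow> complex"
  define y where "y i = (if i \<in> J then z i else 0)" for i
  have "(\<Sum>i\<in>I. \<Sum>j\<in>I. a i j * y j * cnj (y i)) = (\<Sum>i\<in>J. \<Sum>j\<in>I. a i j * y j * cnj (y i))"
    using assms by (intro sum.mono_neutral_right) (auto simp: y_def)
  also have "\<dots> = (\<Sum>i\<in>J. \<Sum>j\<in>J. a i j * z j * cnj (z i))"
    using assms by (intro sum.cong refl sum.mono_neutral_cong_right) (auto simp: y_def)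
  finally show "(\<Sum>i\<in>J. \<Sum>j\<in>J. a i j * z j * cnj (z i)) \<in> \<real>\<^sub>\<ge>\<^sub>0"
    using assms(1)[unfolded positive_kernel_def, rule_format, of y] by (simp only:)
qed

lemma positive_kernel_diagonal:
  assumes "positive_kernel I a" "finite I" "i \<in> I"
  shows "a i i \<in> \<real>\<^sub>\<ge>\<^sub>0"
proof -
  have "positive_kernel {i} a" by (rule positive_kernel_subset[of I]) (use assms in auto)
  from this[unfolded positive_kernel_def, rule_format, of "\<lambda>_. 1"] show ?thesis by simp
qed

text \<open>Both claims concern a two by two principal submatrix. If \<open>a j j = 0\<close>, the
  test vectors below give \<open>2 * t * cmod (a i j) \<le> a i i\<close> for arbitrarily large
  \<open>t\<close>.\<close>

lemma positive_kernel_pair: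
  assumes a: "positive_kernel I a" "finite I" "i \<in> I" "j \<in> I"
  shows "a j i = cnj (a i j)" and "a j j = 0 \<Longrightarrow> a i j = 0"
proof -
  have "a j i = cnj (a i j) \<and> (a j j = 0 \<longrightarrow> a i j = 0)"
  proof (cases "i = j")
    case True
    have "a j j \<in> \<real>" using positive_kernel_diagonal[OF a(1,2,4)] nonneg_Reals_subset_Reals by blast
    then show ?thesis using True by (simp add: Reals_cnj_iff)
  next
    case False
    have "positive_kernel {i, j} a" by (rule positive_kernel_subset[of I]) (use a in auto)
    then have "(\<Sum>k\<in>{i, j}. \<Sum>l\<in>{i, j}. a k l * z l * cnj (z k)) \<in> \<real>\<^sub>\<ge>\<^sub>0" for z
      by (simp add: positive_kernel_def)
    \<comment> \<open>Test vectors with entry 1 at \<open>i\<close> and \<open>t * u\<close> at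
      \<open>j\<close>: \<open>u\<close> will run over the unit circle, \<open>t\<close> over
      scales.\<close>
    from this[of "\<lambda>k. if k = i then 1 else of_real t * u" for t u]
    have nn: "a i i + of_real t * u * a i j + of_real t * cnj u * a j i
        + of_real (t\<^sup>2) * (u * cnj u) * a j j \<in> \<real>\<^sub>\<ge>\<^sub>0" for t u
      using False by (simp add: algebra_simps power2_eq_square)
    obtain c d where c: "a i i = of_real c" and d: "a j j = of_real d"
      using positive_kernel_diagonal[OF a(1,2,3)] positive_kernel_diagonal[OF a(1,2,4)]
      by (auto elim!: nonneg_Reals_cases)
    have rot: "complex_of_real (c + t\<^sup>2 * d) + u * (of_real t * a i j) + cnj u * (of_real t * a j i) \<in> \<real>\<^sub>\<ge>\<^sub>0"
      if "cmod u = 1" for t u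
    proof -
      have "u * cnj u = 1" using that by (simp add: complex_norm_square[symmetric])
      then show ?thesis using nn[of t u] by (simp add: c d algebra_simps)
    qed
    have herm: "a j i = cnj (a i j)"
      using rotation_nonneg(1)[OF rot[of _ 1]] by simp
    have "a i j = 0" if "d = 0"
    proof (rule ccontr)
      assume "a i j \<noteq> 0"
      then obtain n where n: "c < real n * cmod (a i j)"
        using reals_Archimedean3[of "cmod (a i j)"] by auto
      moreover have "2 * (real n * cmod (a i j)) \<le> c"
        using rotation_nonneg(2)[OF rot[of _ "real n"]] that by (simp add: norm_mult)
      moreover have "0 \<le> real n * cmod (a i j)" by simp
      ultimately show False by linarith
    qed
    with herm d show ?thesis by simp
  qed
  then show "a j i = cnj (a i j)" "a j j = 0 \<Longrightarrow> a i j = 0" by auto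
qed

text \<open>Cholesky factorisation: subtract the rank one kernel that clears one row and column.\<close>

lemma positive_kernel_gram:
  assumes "finite I" and "positive_kernel I a"
  shows "\<exists>v m. \<forall>i\<in>I. \<forall>j\<in>I. a i j = (\<Sum>k<(m::nat). v k i * cnj (v k j))"
  using assms
proof (induction I arbitrary: a rule: finite_induct)
  case empty
  then show ?case by simp
next
  case (insert x F)
  have fin: "finite (insert x F)" using insert by simp
  note pk = insert.prems
  obtain d where d: "a x x = of_real d" "d \<ge> 0"
    using positive_kernel_diagonal[OF pk fin insertI1] by (auto elim!: nonneg_Reals_cases)
  have herm: "a j i = cnj (a i j)" if "i \<in> insert x F" "j \<in> insert x F" for i j
    using positive_kernel_pair(1)[OF pk fin that] .
  define b where "b i j = a i j - a i x * a x j / of_real d" for i j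
  \<comment> \<open>True also for \<open>d = 0\<close>: then \<open>a i x = 0\<close> and the
    quotient is 0 by the convention on division.\<close>
  have row: "a i x * cnj (a x x) / of_real d = a i x" if "i \<in> insert x F" for i
    using positive_kernel_pair(2)[OF pk fin that, of x] d by (cases "d = 0") auto
  have "positive_kernel F b"
    unfolding positive_kernel_def
  proof
    fix z :: "'a \<Rightarrow> complex"
    define s where "s = (\<Sum>j\<in>F. a x j * z j)"
    \<comment> \<open>The entry at \<open>x\<close> completes the square in that coordinate, so the
      form of \<open>a\<close> at \<open>y\<close> equals the form of \<open>b\<close> at
      \<open>z\<close>. For \<open>d = 0\<close> it is 0.\<close>
    define y where "y = z(x := - s / of_real d)"
    define w where "w = (\<Sum>i\<in>F. a i x * cnj (z i))"
    have yF: "y i = z i" if "i \<in> F" for i using that insert.hyps by (auto simp: y_def)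
    have sF: "(\<Sum>j\<in>F. a x j * y j) = s" by (simp add: s_def yF)
    have "(\<Sum>i\<in>insert x F. \<Sum>j\<in>insert x F. a i j * y j * cnj (y i))
        = a x x * y x * cnj (y x) + s * cnj (y x) + w * y x + (\<Sum>i\<in>F. \<Sum>j\<in>F. a i j * z j * cnj (z i))"
      using insert.hyps
      by (simp add: sum.distrib sF[symmetric] w_def yF sum_distrib_left sum_distrib_right mult_ac)
    also have "\<dots> = (\<Sum>i\<in>F. \<Sum>j\<in>F. a i j * z j * cnj (z i)) - w * s / of_real d"
    proof (cases "d = 0")
      case True
      then show ?thesis by (simp add: y_def d)
    next
      case False
      then show ?thesis by (simp add: y_def d field_simps)
    qed
    also have "\<dots> = (\<Sum>i\<in>F. \<Sum>j\<in>F. b i j * z j * cnj (z i))"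
      unfolding w_def s_def sum_product sum_divide_distrib sum_subtractf[symmetric] b_def
      by (intro sum.cong refl) (simp add: algebra_simps)
    finally show "(\<Sum>i\<in>F. \<Sum>j\<in>F. b i j * z j * cnj (z i)) \<in> \<real>\<^sub>\<ge>\<^sub>0"
      using pk[unfolded positive_kernel_def, rule_format, of y] by (simp only:)
  qed
  then obtain v and m :: nat where v: "\<And>i j. i \<in> F \<Longrightarrow> j \<in> F \<Longrightarrow> b i j = (\<Sum>k<m. v k i * cnj (v k j))"
    using insert.IH by blast
  \<comment> \<open>The new vector, at position \<open>m\<close>, is the column of \<open>x\<close>
    divided by \<open>sqrt d\<close>; the old ones are extended by 0 at \<open>x\<close>.\<close>
  define v' where "v' k i = (if k = m then a i x / of_real (sqrt d) else if i = x then 0 else v k i)" for k i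
  have sqrt: "complex_of_real (sqrt d) * complex_of_real (sqrt d) = of_real d"
    using d by (simp add: of_real_mult[symmetric] del: of_real_mult)
  have "a i j = (\<Sum>k<Suc m. v' k i * cnj (v' k j))" if ij: "i \<in> insert x F" "j \<in> insert x F" for i j
  proof -
    have last: "v' m i * cnj (v' m j) = a i x * a x j / of_real d"
      using herm[OF ij(2), of x] by (simp add: v'_def sqrt)
    have "(\<Sum>k<m. v' k i * cnj (v' k j)) = b i j"
    \<comment> \<open>In the row and column of \<open>x\<close> the rank one term already equals
      \<open>a\<close>, so \<open>b\<close> vanishes there.\<close>
    proof (cases "i = x \<or> j = x")
      case True
      have "a i j = a i x * a x j / of_real d"
        using True
      proof
        assume "j = x"
        then show ?thesis using row[OF ij(1)] d by simp
      next
        assume "i = x"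
        then show ?thesis using row[OF ij(2)] herm[OF ij(2), of x] d by (auto simp: field_simps split: if_splits)
      qed
      moreover have "(\<Sum>k<m. v' k i * cnj (v' k j)) = 0"
        using True by (intro sum.neutral) (auto simp: v'_def)
      ultimately show ?thesis by (simp add: b_def)
    next
      case False
      then show ?thesis using ij v[of i j] by (simp add: v'_def)
    qed
    then show ?thesis by (simp add: last b_def)
  qed
  then show ?case by blast
qed

subsection \<open>Complete positivity\<close>

lemma sum_nonneg_Reals: "(\<And>i. i \<in> I \<Longrightarrow> f i \<in> \<real>\<^sub>\<ge>\<^sub>0) \<Longrightarrow> (\<Sum>i\<in>I. f i) \<in> (\<real>\<^sub>\<ge>\<^sub>0 :: complex set)"
  by (induction I rule: infinite_finite_induct) auto

text \<open>A scalar family on pairs is regrouped into \<open>n\<close> vectors, one per block, and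
  the operator form evaluated entrywise.\<close>

lemma positive_operator_matrix_kernel:
  fixes A :: "nat \<Rightarrow> nat \<Rightarrow> complex ^ 'k ^ 'k"
  assumes "positive_operator_matrix n (\<lambda>i j. (*v) (A i j))"
  shows "positive_kernel ({..<n} \<times> UNIV) (\<lambda>(i, k) (j, l). A i j $ k $ l)"
  unfolding positive_kernel_def
proof
  fix z :: "nat \<times> 'k \<Rightarrow> complex"
  define \<xi> :: "nat \<Rightarrow> complex ^ 'k" where "\<xi> j = (\<chi> l. z (j, l))" for j
  have "(\<Sum>p\<in>{..<n} \<times> UNIV. \<Sum>r\<in>{..<n} \<times> UNIV. (case p of (i, k) \<Rightarrow> \<lambda>(j, l). A i j $ k $ l) r * z r * cnj (z p))
    = (\<Sum>i<n. \<Sum>k\<in>UNIV. \<Sum>j<n. \<Sum>l\<in>UNIV. A i j $ k $ l * z (j, l) * cnj (z (i, k)))"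
    by (simp only: sum.cartesian_product[symmetric] sum.cartesian_product' prod.case split_beta fst_conv snd_conv)
  also have "\<dots> = (\<Sum>i<n. cinner (\<Sum>j<n. A i j *v \<xi> j) (\<xi> i))"
    by (simp add: cinner_vec_def cinner_complex_def matrix_vector_mult_def \<xi>_def sum_distrib_right)
  finally show "(\<Sum>p\<in>{..<n} \<times> UNIV. \<Sum>r\<in>{..<n} \<times> UNIV. (case p of (i, k) \<Rightarrow> \<lambda>(j, l). A i j $ k $ l) r * z r * cnj (z p)) \<in> \<real>\<^sub>\<ge>\<^sub>0"
    using assms by (simp add: positive_operator_matrix_def)
qed

text \<open>A Gram decomposition of the scalar kernel \<open>A i j $ k $ l\<close> turns the quadratic form of the
  matrix of images into a sum of values of the form of the Choi matrix \<open>C\<close>.\<close>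

lemma completely_positive_choi:
  fixes C :: "'k::finite \<Rightarrow> 'k \<Rightarrow> 'a::complex_hilbert \<Rightarrow> 'a"
  assumes C: "\<And>k l. C k l \<in> bounded_operators"
    and pos: "\<And>x. (\<Sum>k\<in>UNIV. \<Sum>l\<in>UNIV. cinner (C k l (x l)) (x k)) \<in> \<real>\<^sub>\<ge>\<^sub>0"
  shows "completely_positive (\<lambda>A x. \<Sum>k\<in>UNIV. \<Sum>l\<in>UNIV. A $ k $ l *\<^sub>C C k l x)"
    (is "completely_positive ?\<phi>")
proof -
  have bounded: "?\<phi> A \<in> bounded_operators" for A
    by (intro bounded_operators_sum bounded_operators_scaleC C)
  have C_sum: "C k l (\<Sum>j\<in>J. f j) = (\<Sum>j\<in>J. C k l (f j))" for k l J and f :: "nat \<Rightarrow> 'a"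
    using C[of k l] by (auto simp: bounded_operators_def intro: linear_sum bounded_linear.linear)
  have C_scale: "C k l (c *\<^sub>C x) = c *\<^sub>C C k l x" for k l c x
    using C[of k l] by (simp add: bounded_operators_def)
  have "(\<Sum>i<n. cinner (\<Sum>j<n. ?\<phi> (A i j) (\<xi> j)) (\<xi> i)) \<in> \<real>\<^sub>\<ge>\<^sub>0"
    if A: "positive_operator_matrix n (\<lambda>i j. (*v) (A i j))" for n and A :: "nat \<Rightarrow> nat \<Rightarrow> complex ^ 'k ^ 'k" and \<xi>
  proof -
    obtain v and m :: nat where v: "\<forall>p\<in>{..<n} \<times> UNIV. \<forall>r\<in>{..<n} \<times> UNIV.
        (case p of (i, k) \<Rightarrow> \<lambda>(j, l). A i j $ k $ l) r = (\<Sum>s<m. v s p * cnj (v s r))"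
      using positive_kernel_gram[OF _ positive_operator_matrix_kernel[OF A]] by auto
    \<comment> \<open>Each Gram vector is absorbed into the arguments. The \<open>cnj\<close> here
      is undone in the second slot of \<open>cinner\<close>, which yields
      \<open>v s (i, k)\<close>.\<close>
    define X where "X s l = (\<Sum>j<n. cnj (v s (j, l)) *\<^sub>C \<xi> j)" for s l
    define F where "F s k l i j = v s (i, k) * cnj (v s (j, l)) * cinner (C k l (\<xi> j)) (\<xi> i)" for s k l i j
    have X: "cinner (C k l (X s l)) (X s k) = (\<Sum>i<n. \<Sum>j<n. F s k l i j)" for s k l
    proof -
      have "cinner (C k l (X s l)) (X s k) = (\<Sum>i<n. v s (i, k) * cinner (C k l (X s l)) (\<xi> i))"
        by (simp add: X_def[of s k] cinner_sum_right cinner_simps)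
      also have "\<dots> = (\<Sum>i<n. \<Sum>j<n. F s k l i j)"
        by (simp add: X_def C_sum C_scale cinner_sum_left cinner_simps sum_distrib_left F_def mult.assoc)
      finally show ?thesis .
    qed
    have "(\<Sum>i<n. cinner (\<Sum>j<n. ?\<phi> (A i j) (\<xi> j)) (\<xi> i))
        = (\<Sum>i<n. \<Sum>j<n. \<Sum>k\<in>UNIV. \<Sum>l\<in>UNIV. A i j $ k $ l * cinner (C k l (\<xi> j)) (\<xi> i))"
      by (simp add: cinner_sum_left cinner_simps)
    also have "\<dots> = (\<Sum>i<n. \<Sum>j<n. \<Sum>k\<in>UNIV. \<Sum>l\<in>UNIV. \<Sum>s<m. F s k l i j)"
    proof (intro sum.cong refl)
      fix i j k l assume "i \<in> {..<n}" "j \<in> {..<n}"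
      then have "A i j $ k $ l = (\<Sum>s<m. v s (i, k) * cnj (v s (j, l)))"
        using v by force
      then show "A i j $ k $ l * cinner (C k l (\<xi> j)) (\<xi> i) = (\<Sum>s<m. F s k l i j)"
        by (simp add: F_def sum_distrib_right)
    qed
    \<comment> \<open>With \<open>s\<close> outermost, each summand becomes the Choi form at
      \<open>X s\<close>.\<close>
    also have "\<dots> = (\<Sum>s<m. \<Sum>i<n. \<Sum>j<n. \<Sum>k\<in>UNIV. \<Sum>l\<in>UNIV. F s k l i j)"
      by (simp only: sum.swap[where B = "{..<m}"])
    also have "\<dots> = (\<Sum>s<m. \<Sum>k\<in>UNIV. \<Sum>l\<in>UNIV. \<Sum>i<n. \<Sum>j<n. F s k l i j)"
      by (simp only: sum.swap[where A = "UNIV::'k set" and B = "{..<n}"])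
    also have "\<dots> = (\<Sum>s<m. \<Sum>k\<in>UNIV. \<Sum>l\<in>UNIV. cinner (C k l (X s l)) (X s k))"
      by (simp only: X)
    finally show ?thesis using pos by (simp add: sum_nonneg_Reals)
  qed
  then show ?thesis
    unfolding completely_positive_def positive_operator_matrix_def
    by (auto simp: bounded scaleC_add_left sum.distrib scaleC_sum_right scaleC_scaleC scaleC_vec_def scaleC_complex_def)
qed

section \<open>Matrices as operators, and the positive matrices to be mapped\<close>

lemma matrix_bounded_operator: "(*v) (M :: complex ^ 'k ^ 'k) \<in> bounded_operators"
proof -
  have "bounded_linear ((*v) M)"
    unfolding linear_conv_bounded_linear[symmetric]
    by (rule linearI, rule matrix_vector_right_distrib)
      (simp add: matrix_vector_mult_def vec_eq_iff scaleR_sum_right)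
  then show ?thesis
    by (auto simp: bounded_operators_def matrix_vector_mult_def scaleC_vec_def vec_eq_iff
        scaleC_complex_def sum_distrib_left mult_ac)
qed

text \<open>Only \<open>\<xi> 0\<close> enters the sum, so constant families suffice as test
  vectors.\<close>

lemma positive_operator_matrix_1: "positive_operator_matrix 1 (\<lambda>i j. M) \<longleftrightarrow> positive_operator M"
  unfolding positive_operator_matrix_def positive_operator_def
  by (auto dest: spec[of _ "\<lambda>_. _"])

text \<open>As \<open>u * cnj u = 1\<close>, the quadratic form is the single square
  \<open>(cmod (\<xi> $ 1 + cnj u * \<xi> $ 2))\<^sup>2\<close>.\<close>

lemma positive_rotated_E21:
  assumes u: "cmod u = 1"
  defines "E12 \<equiv> vector [vector [0, 1], vector [0, 0]] :: complex ^ 2 ^ 2"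
  shows "positive_operator ((*v) (mat 1 + (u *\<^sub>C E21 + cnj u *\<^sub>C E12)))"
  unfolding positive_operator_def
proof (intro conjI allI matrix_bounded_operator)
  fix \<xi> :: "complex ^ 2"
  have "u * cnj u = 1" using u by (simp add: complex_norm_square[symmetric])
  then have "cinner ((mat 1 + (u *\<^sub>C E21 + cnj u *\<^sub>C E12)) *v \<xi>) \<xi>
      = (\<xi> $ 1 + cnj u * \<xi> $ 2) * cnj (\<xi> $ 1 + cnj u * \<xi> $ 2)"
    by (simp add: cinner_vec_def cinner_complex_def sum_2 matrix_vector_mult_def mat_def E21_def
        E12_def scaleC_vec_def scaleC_complex_def vector_2 algebra_simps)
  also have "\<dots> = of_real ((cmod (\<xi> $ 1 + cnj u * \<xi> $ 2))\<^sup>2)" by (rule complex_norm_square[symmetric])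
  finally show "cinner ((mat 1 + (u *\<^sub>C E21 + cnj u *\<^sub>C E12)) *v \<xi>) \<xi> \<in> \<real>\<^sub>\<ge>\<^sub>0" by simp
qed

theorem corollary5p6:
  fixes T :: "'a::complex_hilbert \<Rightarrow> 'a"
  assumes "T \<in> bounded_operators"
  shows "numerical_radius T \<le> 1 / 2 \<longleftrightarrow>
    (\<exists>\<phi> :: complex ^ 2 ^ 2 \<Rightarrow> 'a \<Rightarrow> 'a.
       unital \<phi> \<and> completely_positive \<phi> \<and> T = \<phi> E21)"
proof
  assume radius: "numerical_radius T \<le> 1 / 2"
  have w: "2 * cmod (cinner (T x) x) \<le> (norm x)\<^sup>2" for x
    using cmod_cinner_le_numerical_radius[OF assms, of x] mult_right_mono[OF radius, of "(norm x)\<^sup>2"]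
    by simp
  obtain q where q: "\<And>x. 0 \<le> q x" "\<And>x. q x \<le> (norm x)\<^sup>2"
    "\<And>x y. q (x + y) + q (x - y) = 2 * q x + 2 * q y"
    "\<And>c x. q (c *\<^sub>C x) = (cmod c)\<^sup>2 * q x"
    and qT: "\<And>x y. q x \<le> (norm x)\<^sup>2 + 2 * Re (cinner (T x) y) + q y"
    using toeplitz_schur_complement[OF assms w] by blast
  obtain A where A: "A \<in> bounded_operators" "\<And>x. cinner (A x) x = of_real (q x)"
    using jordan_von_neumann[of q] q by blast
  obtain S where S: "S \<in> bounded_operators" "\<And>x y. cinner (S x) y = cinner x (T y)"
    using adjoint_exists[OF assms] by blast
  \<comment> \<open>The Choi matrix: its diagonal sums to the identity, which gives unitality, and
    \<open>T\<close> sits at the position of \<open>E21\<close>.\<close>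
  define C :: "2 \<Rightarrow> 2 \<Rightarrow> 'a \<Rightarrow> 'a" where
    "C k l = (if k = 1 then if l = 1 then (\<lambda>x. x - A x) else S else if l = 1 then T else A)" for k l
  let ?\<phi> = "\<lambda>M x. \<Sum>k\<in>UNIV. \<Sum>l\<in>UNIV. M $ k $ l *\<^sub>C C k l x"
  have "completely_positive ?\<phi>"
  proof (rule completely_positive_choi)
    show "C k l \<in> bounded_operators" for k l
      by (simp add: C_def A S assms bounded_operators_diff bounded_operators_id)
    fix x :: "2 \<Rightarrow> 'a"
    have "cinner (S (x 2)) (x 1) = cnj (cinner (T (x 1)) (x 2))"
      using S(2) cinner_commute by metis
    then have "(\<Sum>k\<in>UNIV. \<Sum>l\<in>UNIV. cinner (C k l (x l)) (x k))
        = of_real ((norm (x 1))\<^sup>2 - q (x 1) + 2 * Re (cinner (T (x 1)) (x 2)) + q (x 2))"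
      by (simp add: sum_2 C_def A cinner_simps cinner_self complex_eq_iff)
    \<comment> \<open>Positivity of the Choi matrix is exactly the last property of
      \<open>q\<close>.\<close>
    moreover have "0 \<le> (norm (x 1))\<^sup>2 - q (x 1) + 2 * Re (cinner (T (x 1)) (x 2)) + q (x 2)"
      using qT[of "x 1" "x 2"] by simp
    ultimately show "(\<Sum>k\<in>UNIV. \<Sum>l\<in>UNIV. cinner (C k l (x l)) (x k)) \<in> \<real>\<^sub>\<ge>\<^sub>0"
      by (simp only: nonneg_Reals_of_real_iff)
  qed
  moreover have "unital ?\<phi>"
    by (simp add: unital_def mat_def sum_2 C_def scaleC_one scaleC_zero_left)
  moreover have "T = ?\<phi> E21"
    by (simp add: E21_def sum_2 C_def scaleC_one scaleC_zero_left)
  ultimately show "\<exists>\<phi>. unital \<phi> \<and> completely_positive \<phi> \<and> T = \<phi> E21" by blast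
next
  assume "\<exists>\<phi> :: complex ^ 2 ^ 2 \<Rightarrow> 'a \<Rightarrow> 'a. unital \<phi> \<and> completely_positive \<phi> \<and> T = \<phi> E21"
  then obtain \<phi> :: "complex ^ 2 ^ 2 \<Rightarrow> 'a \<Rightarrow> 'a"
    where unital: "unital \<phi>" and cp: "completely_positive \<phi>" and T: "T = \<phi> E21" by blast
  define E12 :: "complex ^ 2 ^ 2" where "E12 = vector [vector [0, 1], vector [0, 0]]"
  have cp_n: "positive_operator_matrix n (\<lambda>i j. \<phi> (M i j))"
    if "positive_operator_matrix n (\<lambda>i j. (*v) (M i j))" for n M
    using cp that by (simp add: completely_positive_def)
  \<comment> \<open>\<open>state_bound\<close> with \<open>c = 1\<close> and
    \<open>\<phi> E12\<close> in the place of the adjoint; positivity of \<open>\<phi>\<close> at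
    the first matrix level is used.\<close>
  have "2 * cmod (f T) \<le> 1" if "state f" for f
  proof (rule state_bound[OF that assms])
    show "\<phi> E12 \<in> bounded_operators" using cp by (simp add: completely_positive_def)
    fix u :: complex assume "cmod u = 1"
    then have "positive_operator_matrix 1 (\<lambda>i j. (*v) (mat 1 + (u *\<^sub>C E21 + cnj u *\<^sub>C E12)))"
      unfolding positive_operator_matrix_1 E12_def by (rule positive_rotated_E21)
    then have "positive_operator_matrix 1 (\<lambda>i j. \<phi> (mat 1 + (u *\<^sub>C E21 + cnj u *\<^sub>C E12)))"
      by (rule cp_n)
    then show "positive_operator (\<lambda>x. 1 *\<^sub>R x + (u *\<^sub>C T x + cnj u *\<^sub>C \<phi> E12 x))"
      using cp unital unfolding positive_operator_matrix_1
      by (simp add: completely_positive_def unital_def T)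
  qed
  then have "cmod (f T) \<le> 1 / 2" if "state f" for f using that by force
  \<comment> \<open>The inserted 0 provides the nonemptiness required by \<open>cSUP_least\<close>,
    even when there are no states.\<close>
  then show "numerical_radius T \<le> 1 / 2"
    unfolding numerical_radius_def by (intro cSUP_least) (auto simp: numerical_range_def)
qed

end
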